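(* Let $K$ be an $O$-category. Then $K$ has locally determined $\omega$-colimits of adjoint pairs if and only if for every $O$-category $L$ and every locally continuous functor $F : K \to L$, the induced functor $F_{\mathrm{Adj}} : K_{\mathrm{Adj}} \to L_{\mathrm{Adj}}$ is $\omega$-cocontinuous.
   Context: An $O$-category is a category each of whose hom-sets is equipped with a partial order having least upper bounds of all $\omega$-chains $f_0 \le f_1 \le \cdots$ (a least element is not required), such that composition is monotone and preserves least upper bounds of $\omega$-chains in each argument. A functor $F : K \to L$ between $O$-categories is locally continuous when its action on each hom-set is monotone and preserves least upper bounds of $\omega$-chains. For an $O$-category $K$, an adjoint pair $f : A \to B$ is a pair $f = \langle f^L : A \to B,\ f^R : B \to A\rangle$ of morphisms of $K$ with $f^L \circ f^R \le \mathrm{id}_B$ and $\mathrm{id}_A \le f^R \circ f^L$. The category $K_{\mathrm{Adj}}$ has the objects of $K$ and, as morphisms $A \to B$, the adjoint pairs $A\to B$, with $(g\circ f)^L = g^L\circ f^L$ and $(g \circ f)^R = f^R \circ g^R$. A locally continuous functor $F : K \to L$ induces a functor $F_{\mathrm{Adj}} : K_{\mathrm{Adj}} \to L_{\mathrm{Adj}}$, acting as $F$ on objects and by $F_{\mathrm{Adj}} f = \langle F f^L, F f^R\rangle$ on morphisms. An $\omega$-chain of adjoint pairs is a functor $\Delta : (\mathbb{N},\le) \to K_{\mathrm{Adj}}$; write $\Delta_{n\le m} : \Delta_n \to \Delta_m$ for its value at $n \le m$. A cocone $\langle C, c\rangle$ for it consists of an object $C$ and adjoint pairs $c_n : \Delta_n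 \to C$, $n \in\mathbb{N}$, with $c_m\circ\Delta_{n\le m} = c_n$ in $K_{\mathrm{Adj}}$ for all $n \le m$; it is colimiting when it is a colimit of $\Delta$ in $K_{\mathrm{Adj}}$. The cocone is locally determined when $\bigvee_{n\in\mathbb{N}} c_n^L\circ c_n^R = \mathrm{id}_C$ and, for all $n\in\mathbb{N}$, $\bigvee_{m\ge n} \Delta_{n\le m}^R\circ\Delta_{n\le m}^L = c_n^R\circ c_n^L$ (both least upper bounds are of increasing $\omega$-chains). The $O$-category $K$ has locally determined $\omega$-colimits of adjoint pairs when every colimiting cocone for every $\omega$-chain of adjoint pairs in $K$ is locally determined (the existence of colimits is not part of this definition). A functor is $\omega$-cocontinuous when it sends every colimiting cocone for an $\omega$-chain in its domain to a colimiting cocone for the image $\omega$-chain. *)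

theory Defs
  imports Main
begin

record ('o, 'a) category =
  Obj :: "'o set"
  Arr :: "'a set"
  Dom :: "'a \<Rightarrow> 'o"
  Cod :: "'a \<Rightarrow> 'o"
  Ide :: "'o \<Rightarrow> 'a"
  Cmp :: "'a \<Rightarrow> 'a \<Rightarrow> 'a" (infixr "\<cdot>\<index>" 70)

definition hom :: "('o, 'a, 'z) category_scheme \<Rightarrow> 'o \<Rightarrow> 'o \<Rightarrow> 'a set" where
  "hom C A B = {f \<in> Arr C. Dom C f = A \<and> Cod C f = B}"

locale category =
  fixes C (structure)
  assumes Dom_Obj: "f \<in> Arr C \<Longrightarrow> Dom C f \<in> Obj C"
    and Cod_Obj: "f \<in> Arr C \<Longrightarrow> Cod C f \<in> Obj C"
    and Ide_hom: "A \<in> Obj C \<Longrightarrow> Ide C A \<in> hom C A A"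
    and Cmp_hom: "\<lbrakk>f \<in> hom C A B; g \<in> hom C B D\<rbrakk> \<Longrightarrow> g \<cdot> f \<in> hom C A D"
    and Cmp_Ide: "f \<in> hom C A B \<Longrightarrow> f \<cdot> Ide C A = f"
    and Ide_Cmp: "f \<in> hom C A B \<Longrightarrow> Ide C B \<cdot> f = f"
    and Cmp_assoc: "\<lbrakk>f \<in> hom C A B; g \<in> hom C B D; h \<in> hom C D E\<rbrakk>
        \<Longrightarrow> (h \<cdot> g) \<cdot> f = h \<cdot> (g \<cdot> f)"

record ('o, 'a, 'p, 'b) functor_map =
  fobj :: "'o \<Rightarrow> 'p"
  farr :: "'a \<Rightarrow> 'b"

definition is_functor ::
  "('o, 'a, 'y) category_scheme \<Rightarrow> ('p, 'b, 'z) category_scheme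
    \<Rightarrow> ('o, 'a, 'p, 'b) functor_map \<Rightarrow> bool" where
  "is_functor C D F \<longleftrightarrow>
    (\<forall>A\<in>Obj C. fobj F A \<in> Obj D) \<and>
    (\<forall>A\<in>Obj C. \<forall>B\<in>Obj C. \<forall>f\<in>hom C A B. farr F f \<in> hom D (fobj F A) (fobj F B)) \<and>
    (\<forall>A\<in>Obj C. farr F (Ide C A) = Ide D (fobj F A)) \<and>
    (\<forall>f\<in>Arr C. \<forall>g\<in>Arr C. Cod C f = Dom C g \<longrightarrow>
      farr F (g \<cdot>\<^bsub>C\<^esub> f) = farr F g \<cdot>\<^bsub>D\<^esub> farr F f)"

definition functor_comp ::
  "('p, 'b, 'q, 'c) functor_map \<Rightarrow> ('o, 'a, 'p, 'b) functor_map \<Rightarrow> ('o, 'a, 'q, 'c) functor_map"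
  where
  "functor_comp G F = \<lparr>fobj = fobj G \<circ> fobj F, farr = farr G \<circ> farr F\<rparr>"


text \<open>The poset of natural numbers as a category; the unique arrow witnessing \<open>n \<le> m\<close> is the
  pair \<open>(n, m)\<close>. An \<open>\<omega>\<close>-chain in \<open>C\<close> is a functor from this category to \<open>C\<close>.\<close>

definition omega :: "(nat, nat \<times> nat) category" where
  "omega = \<lparr>Obj = UNIV, Arr = {(n, m). n \<le> m}, Dom = fst, Cod = snd,
    Ide = (\<lambda>n. (n, n)), Cmp = (\<lambda>g f. (fst f, snd g))\<rparr>"

type_synonym ('o, 'a) chain = "(nat, nat \<times> nat, 'o, 'a) functor_map"

definition is_cocone ::
  "('o, 'a, 'z) category_scheme \<Rightarrow> ('o, 'a) chain \<Rightarrow> 'o \<Rightarrow> (nat \<Rightarrow> 'a) \<Rightarrow> bool" where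
  "is_cocone C \<Delta> X c \<longleftrightarrow>
    X \<in> Obj C \<and> (\<forall>n. c n \<in> hom C (fobj \<Delta> n) X) \<and>
    (\<forall>n m. n \<le> m \<longrightarrow> c m \<cdot>\<^bsub>C\<^esub> farr \<Delta> (n, m) = c n)"

definition is_colimiting ::
  "('o, 'a, 'z) category_scheme \<Rightarrow> ('o, 'a) chain \<Rightarrow> 'o \<Rightarrow> (nat \<Rightarrow> 'a) \<Rightarrow> bool" where
  "is_colimiting C \<Delta> X c \<longleftrightarrow>
    is_cocone C \<Delta> X c \<and>
    (\<forall>Y d. is_cocone C \<Delta> Y d \<longrightarrow> (\<exists>!h. h \<in> hom C X Y \<and> (\<forall>n. h \<cdot>\<^bsub>C\<^esub> c n = d n)))"

definition omega_cocontinuous ::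
  "('o, 'a, 'y) category_scheme \<Rightarrow> ('p, 'b, 'z) category_scheme
    \<Rightarrow> ('o, 'a, 'p, 'b) functor_map \<Rightarrow> bool" where
  "omega_cocontinuous C D F \<longleftrightarrow>
    (\<forall>\<Delta> X c. is_functor omega C \<Delta> \<and> is_colimiting C \<Delta> X c \<longrightarrow>
      is_colimiting D (functor_comp F \<Delta>) (fobj F X) (\<lambda>n. farr F (c n)))"


record ('o, 'a) O_category = "('o, 'a) category" +
  Le :: "'a \<Rightarrow> 'a \<Rightarrow> bool" (infix "\<sqsubseteq>\<index>" 50)

text \<open>The relation \<open>Le\<close> is only meaningful between arrows of the same hom-set, and least upper
  bounds are taken within a hom-set.\<close>

definition is_lub ::
  "('o, 'a, 'z) O_category_scheme \<Rightarrow> 'o \<Rightarrow> 'o \<Rightarrow> 'a set \<Rightarrow> 'a \<Rightarrow> bool" where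
  "is_lub K A B S s \<longleftrightarrow>
    s \<in> hom K A B \<and> (\<forall>f\<in>S. f \<sqsubseteq>\<^bsub>K\<^esub> s) \<and>
    (\<forall>t\<in>hom K A B. (\<forall>f\<in>S. f \<sqsubseteq>\<^bsub>K\<^esub> t) \<longrightarrow> s \<sqsubseteq>\<^bsub>K\<^esub> t)"

definition increasing ::
  "('o, 'a, 'z) O_category_scheme \<Rightarrow> 'o \<Rightarrow> 'o \<Rightarrow> (nat \<Rightarrow> 'a) \<Rightarrow> bool" where
  "increasing K A B f \<longleftrightarrow> (\<forall>n. f n \<in> hom K A B \<and> f n \<sqsubseteq>\<^bsub>K\<^esub> f (Suc n))"

locale O_category = category K for K (structure) +
  assumes Le_refl: "reflp_on (hom K A B) (\<sqsubseteq>)"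
    and Le_trans: "transp_on (hom K A B) (\<sqsubseteq>)"
    and Le_antisym: "antisymp_on (hom K A B) (\<sqsubseteq>)"
    and lub_exists: "increasing K A B u \<Longrightarrow> \<exists>s. is_lub K A B (range u) s"
    and Cmp_mono: "\<lbrakk>f \<in> hom K A B; f' \<in> hom K A B; g \<in> hom K B D; g' \<in> hom K B D;
        f \<sqsubseteq> f'; g \<sqsubseteq> g'\<rbrakk> \<Longrightarrow> g \<cdot> f \<sqsubseteq> g' \<cdot> f'"
    and Cmp_lub_right: "\<lbrakk>increasing K A B u; is_lub K A B (range u) s; g \<in> hom K B D\<rbrakk>
        \<Longrightarrow> is_lub K A D (range (\<lambda>n. g \<cdot> u n)) (g \<cdot> s)"
    and Cmp_lub_left: "\<lbrakk>increasing K B D u; is_lub K B D (range u) s; f \<in> hom K A B\<rbrakk>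
        \<Longrightarrow> is_lub K A D (range (\<lambda>n. u n \<cdot> f)) (s \<cdot> f)"

definition locally_continuous ::
  "('o, 'a, 'y) O_category_scheme \<Rightarrow> ('p, 'b, 'z) O_category_scheme
    \<Rightarrow> ('o, 'a, 'p, 'b) functor_map \<Rightarrow> bool" where
  "locally_continuous K L F \<longleftrightarrow>
    is_functor K L F \<and>
    (\<forall>A\<in>Obj K. \<forall>B\<in>Obj K. \<forall>f\<in>hom K A B. \<forall>g\<in>hom K A B.
      f \<sqsubseteq>\<^bsub>K\<^esub> g \<longrightarrow> farr F f \<sqsubseteq>\<^bsub>L\<^esub> farr F g) \<and>
    (\<forall>A\<in>Obj K. \<forall>B\<in>Obj K. \<forall>f s. increasing K A B f \<and> is_lub K A B (range f) s \<longrightarrow>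
      is_lub L (fobj F A) (fobj F B) (range (\<lambda>n. farr F (f n))) (farr F s))"


text \<open>An adjoint pair is represented as \<open>(f\<^sup>L, f\<^sup>R)\<close>.\<close>

definition Adj :: "('o, 'a, 'z) O_category_scheme \<Rightarrow> ('o, 'a \<times> 'a) category" where
  "Adj K = \<lparr>Obj = Obj K,
    Arr = {(l, r). l \<in> Arr K \<and> r \<in> hom K (Cod K l) (Dom K l) \<and>
      l \<cdot>\<^bsub>K\<^esub> r \<sqsubseteq>\<^bsub>K\<^esub> Ide K (Cod K l) \<and> Ide K (Dom K l) \<sqsubseteq>\<^bsub>K\<^esub> r \<cdot>\<^bsub>K\<^esub> l},
    Dom = (\<lambda>(l, r). Dom K l), Cod = (\<lambda>(l, r). Cod K l),
    Ide = (\<lambda>A. (Ide K A, Ide K A)),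
    Cmp = (\<lambda>g f. (fst g \<cdot>\<^bsub>K\<^esub> fst f, snd f \<cdot>\<^bsub>K\<^esub> snd g))\<rparr>"

definition Adj_map :: "('o, 'a, 'p, 'b) functor_map \<Rightarrow> ('o, 'a \<times> 'a, 'p, 'b \<times> 'b) functor_map" where
  "Adj_map F = \<lparr>fobj = fobj F, farr = (\<lambda>(l, r). (farr F l, farr F r))\<rparr>"

definition locally_determined ::
  "('o, 'a, 'z) O_category_scheme \<Rightarrow> ('o, 'a \<times> 'a) chain \<Rightarrow> 'o \<Rightarrow> (nat \<Rightarrow> 'a \<times> 'a) \<Rightarrow> bool" where
  "locally_determined K \<Delta> X c \<longleftrightarrow>
    is_lub K X X {fst (c n) \<cdot>\<^bsub>K\<^esub> snd (c n) | n. True} (Ide K X) \<and>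
    (\<forall>n. is_lub K (fobj \<Delta> n) (fobj \<Delta> n)
      {snd (farr \<Delta> (n, m)) \<cdot>\<^bsub>K\<^esub> fst (farr \<Delta> (n, m)) | m. n \<le> m}
      (snd (c n) \<cdot>\<^bsub>K\<^esub> fst (c n)))"

definition has_locally_determined_colimits :: "('o, 'a, 'z) O_category_scheme \<Rightarrow> bool" where
  "has_locally_determined_colimits K \<longleftrightarrow>
    (\<forall>\<Delta> X c. is_functor omega (Adj K) \<Delta> \<and> is_colimiting (Adj K) \<Delta> X c \<longrightarrow>
      locally_determined K \<Delta> X c)"


lemma category_omega: "category omega"
  by unfold_locales (auto simp: omega_def hom_def)

lemma hom_Adj:
  "(l, r) \<in> hom (Adj K) A B \<longleftrightarrow> l \<in> hom K A B \<and> r \<in> hom K B A \<and>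
    l \<cdot>\<^bsub>K\<^esub> r \<sqsubseteq>\<^bsub>K\<^esub> Ide K B \<and> Ide K A \<sqsubseteq>\<^bsub>K\<^esub> r \<cdot>\<^bsub>K\<^esub> l"
  by (auto simp: Adj_def hom_def)

lemma Adj_simps [simp]:
  "Obj (Adj K) = Obj K" "Ide (Adj K) A = (Ide K A, Ide K A)"
  "(l', r') \<cdot>\<^bsub>Adj K\<^esub> (l, r) = (l' \<cdot>\<^bsub>K\<^esub> l, r \<cdot>\<^bsub>K\<^esub> r')"
  by (simp_all add: Adj_def)

lemma (in category) hom_Obj: "f \<in> hom C A B \<Longrightarrow> A \<in> Obj C \<and> B \<in> Obj C"
  using Dom_Obj Cod_Obj by (auto simp: hom_def)

lemma (in O_category) Le_transD:
  "\<lbrakk>f \<sqsubseteq> g; g \<sqsubseteq> h; f \<in> hom K A B; g \<in> hom K A B; h \<in> hom K A B\<rbrakk> \<Longrightarrow> f \<sqsubseteq> h"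
  using Le_trans[of A B] by (blast dest: transp_onD)

lemma (in O_category) Le_reflI: "f \<in> hom K A B \<Longrightarrow> f \<sqsubseteq> f"
  using Le_refl[of A B] by (blast dest: reflp_onD)

lemma (in O_category) adj_comp:
  assumes "(l, r) \<in> hom (Adj K) A B" and "(l', r') \<in> hom (Adj K) B D"
  shows "(l' \<cdot> l, r \<cdot> r') \<in> hom (Adj K) A D"
proof -
  have l: "l \<in> hom K A B" "r \<in> hom K B A" "l \<cdot> r \<sqsubseteq> Ide K B" "Ide K A \<sqsubseteq> r \<cdot> l"
    and l': "l' \<in> hom K B D" "r' \<in> hom K D B" "l' \<cdot> r' \<sqsubseteq> Ide K D" "Ide K B \<sqsubseteq> r' \<cdot> l'"
    using assms by (auto simp: hom_Adj)
  have ob: "A \<in> Obj K" "B \<in> Obj K" "D \<in> Obj K"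
    using l l' hom_Obj by blast+
  note h = l(1,2) l'(1,2) ob[THEN Ide_hom]
  note rr' = Cmp_hom[OF h(4,2)] and ll' = Cmp_hom[OF h(1,3)]
  have 1: "(l' \<cdot> l) \<cdot> (r \<cdot> r') = l' \<cdot> ((l \<cdot> r) \<cdot> r')"
    by (simp add: Cmp_assoc[OF rr' h(1) h(3)] Cmp_assoc[OF h(4) h(2) h(1)])
  have 2: "(r \<cdot> r') \<cdot> (l' \<cdot> l) = r \<cdot> ((r' \<cdot> l') \<cdot> l)"
    by (simp add: Cmp_assoc[OF ll' h(4) h(2)] Cmp_assoc[OF h(1) h(3) h(4)])
  note lrr' = Cmp_hom[OF h(4) Cmp_hom[OF h(2,1)]] and rll' = Cmp_hom[OF h(1) Cmp_hom[OF h(3,4)]]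
  have "(l \<cdot> r) \<cdot> r' \<sqsubseteq> Ide K B \<cdot> r'"
    by (rule Cmp_mono[OF h(4) h(4) Cmp_hom[OF h(2,1)] h(6) Le_reflI[OF h(4)] l(3)])
  then have "l' \<cdot> ((l \<cdot> r) \<cdot> r') \<sqsubseteq> l' \<cdot> r'"
    using Cmp_mono[OF lrr' h(4) h(3) h(3) _ Le_reflI[OF h(3)]] by (simp add: Ide_Cmp[OF h(4)])
  from Le_transD[OF this l'(3) Cmp_hom[OF lrr' h(3)] Cmp_hom[OF h(4,3)] h(7)]
  have 3: "(l' \<cdot> l) \<cdot> (r \<cdot> r') \<sqsubseteq> Ide K D"
    unfolding 1 .
  have "Ide K B \<cdot> l \<sqsubseteq> (r' \<cdot> l') \<cdot> l"
    by (rule Cmp_mono[OF h(1) h(1) h(6) Cmp_hom[OF h(3,4)] Le_reflI[OF h(1)] l'(4)])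
  then have "r \<cdot> l \<sqsubseteq> r \<cdot> ((r' \<cdot> l') \<cdot> l)"
    using Cmp_mono[OF h(1) rll' h(2) h(2) _ Le_reflI[OF h(2)]] by (simp add: Ide_Cmp[OF h(1)])
  from Le_transD[OF l(4) this h(5) Cmp_hom[OF h(1,2)] Cmp_hom[OF rll' h(2)]]
  have 4: "Ide K A \<sqsubseteq> (r \<cdot> r') \<cdot> (l' \<cdot> l)"
    unfolding 2 .
  show ?thesis
    unfolding hom_Adj by (intro conjI 3 4 rr' ll')
qed

lemma (in O_category) category_Adj: "category (Adj K)"
proof
  fix A B D E f g h
  show "f \<in> Arr (Adj K) \<Longrightarrow> Dom (Adj K) f \<in> Obj (Adj K)"
    "f \<in> Arr (Adj K) \<Longrightarrow> Cod (Adj K) f \<in> Obj (Adj K)"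
    using Dom_Obj Cod_Obj by (auto simp: Adj_def)
  show "A \<in> Obj (Adj K) \<Longrightarrow> Ide (Adj K) A \<in> hom (Adj K) A A"
    by (simp add: hom_Adj Ide_hom Cmp_Ide[OF Ide_hom] Le_reflI[OF Ide_hom])
  show "f \<in> hom (Adj K) A B \<Longrightarrow> g \<in> hom (Adj K) B D \<Longrightarrow> g \<cdot>\<^bsub>Adj K\<^esub> f \<in> hom (Adj K) A D"
    by (cases f; cases g) (simp add: adj_comp)
  show "f \<in> hom (Adj K) A B \<Longrightarrow> f \<cdot>\<^bsub>Adj K\<^esub> Ide (Adj K) A = f"
    "f \<in> hom (Adj K) A B \<Longrightarrow> Ide (Adj K) B \<cdot>\<^bsub>Adj K\<^esub> f = f"
    by (cases f; auto simp: hom_Adj Cmp_Ide Ide_Cmp)+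
  show "f \<in> hom (Adj K) A B \<Longrightarrow> g \<in> hom (Adj K) B D \<Longrightarrow> h \<in> hom (Adj K) D E
      \<Longrightarrow> (h \<cdot>\<^bsub>Adj K\<^esub> g) \<cdot>\<^bsub>Adj K\<^esub> f = h \<cdot>\<^bsub>Adj K\<^esub> g \<cdot>\<^bsub>Adj K\<^esub> f"
    by (cases f; cases g; cases h) (auto simp: hom_Adj Cmp_assoc)
qed

lemma is_functor_Adj_map:
  assumes K: "O_category K" and F: "locally_continuous K L F"
  shows "is_functor (Adj K) (Adj L) (Adj_map F)"
proof -
  interpret K: O_category K by (rule K)
  have ob: "\<And>A. A \<in> Obj K \<Longrightarrow> fobj F A \<in> Obj L"
    and ide: "\<And>A. A \<in> Obj K \<Longrightarrow> farr F (Ide K A) = Ide L (fobj F A)"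
    using F by (auto simp: locally_continuous_def is_functor_def)
  have hm: "farr F f \<in> hom L (fobj F A) (fobj F B)" if "f \<in> hom K A B" for f A B
    using F that K.hom_Obj[OF that] by (auto simp: locally_continuous_def is_functor_def)
  have cmp: "farr F (g \<cdot>\<^bsub>K\<^esub> f) = farr F g \<cdot>\<^bsub>L\<^esub> farr F f"
    if "f \<in> hom K A B" "g \<in> hom K B D" for f g A B D
    using F that by (auto simp: locally_continuous_def is_functor_def hom_def)
  have mono: "farr F f \<sqsubseteq>\<^bsub>L\<^esub> farr F g"
    if "f \<in> hom K A B" "g \<in> hom K A B" "f \<sqsubseteq>\<^bsub>K\<^esub> g" for f g A B
    using F that K.hom_Obj[OF that(1)] by (auto simp: locally_continuous_def)
  have adj: "(farr F l, farr F r) \<in> hom (Adj L) (fobj F A) (fobj F B)"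
    if "(l, r) \<in> hom (Adj K) A B" for l r A B
  proof -
    have l: "l \<in> hom K A B" "r \<in> hom K B A" "l \<cdot>\<^bsub>K\<^esub> r \<sqsubseteq>\<^bsub>K\<^esub> Ide K B" "Ide K A \<sqsubseteq>\<^bsub>K\<^esub> r \<cdot>\<^bsub>K\<^esub> l"
      using that by (auto simp: hom_Adj)
    have o: "A \<in> Obj K" "B \<in> Obj K" using K.hom_Obj[OF l(1)] by auto
    show ?thesis
      using mono[OF K.Cmp_hom[OF l(2,1)] K.Ide_hom[OF o(2)] l(3)]
        mono[OF K.Ide_hom[OF o(1)] K.Cmp_hom[OF l(1,2)] l(4)]
      by (simp add: hom_Adj hm l ide o cmp[OF l(2,1)] cmp[OF l(1,2)])
  qed
  have cmpA: "farr (Adj_map F) (g \<cdot>\<^bsub>Adj K\<^esub> f) = farr (Adj_map F) g \<cdot>\<^bsub>Adj L\<^esub> farr (Adj_map F) f"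
    if "f \<in> Arr (Adj K)" "g \<in> Arr (Adj K)" "Cod (Adj K) f = Dom (Adj K) g" for f g
  proof -
    obtain l r l' r' where fg: "f = (l, r)" "g = (l', r')" by (cases f; cases g)
    define A B D where "A = Dom K l" and "B = Cod K l" and "D = Cod K l'"
    have "l \<in> hom K A B" "r \<in> hom K B A" "l' \<in> hom K B D" "r' \<in> hom K D B"
      using that by (auto simp: fg Adj_def hom_def A_def B_def D_def)
    then show ?thesis by (simp add: fg Adj_map_def cmp)
  qed
  show ?thesis
    unfolding is_functor_def using adj ob ide cmpA by (auto simp: Adj_map_def)
qed


text \<open>HOL cannot quantify over types inside a formula, so a hypothesis about every O-category
  \<open>L\<close> has to fix the types over which \<open>L\<close> is formed. To conclude something about \<open>K\<close> it
  suffices that \<open>L\<close> ranges over O-categories with objects in \<open>'o option\<close> and arrows in the type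
  below. These types can hold a full subcategory of the locally continuous presheaves on \<open>K\<close>
  spanned by the representables and one more presheaf: an arrow is a triple of domain, codomain
  and natural transformation, the elements of every presheaf being coded as sequences of arrows
  of \<open>K\<close> (constant ones for the representables).\<close>

type_synonym ('o, 'a) univ_arr = "'o option \<times> 'o option \<times> ((nat \<Rightarrow> 'a) \<Rightarrow> (nat \<Rightarrow> 'a))"

end

(*
  Whenever a cocone c over a chain of adjoint pairs is locally determined, the mediating pair to
  another cocone d is given by the formulas h^L = lub d_n^L c_n^R and h^R = lub c_n^L d_n^R, so c is
  colimiting. Local determinedness is expressed by least upper bounds of chains and hence preserved
  by locally continuous functors; this gives one direction.

  Conversely, given a chain Delta in K, embed K into an O-category E with one new object that is a
  locally determined colimit of Delta. If the embedding preserves the colimiting cocone c, then its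
  image is isomorphic to a locally determined cocone, hence locally determined, and the embedding
  reflects least upper bounds. Objects of E are chains of adjoint pairs, an object of K being a
  constant chain; an arrow from a chain (G, l, r) to a chain (G', l', r') is a matrix of arrows
  x m n : G n -> G' m with r' x = x and x l = x; composition is matrix multiplication with "lub" for
  the sum, and the identity matrix has the entries lub_p r m p . l n p. This is a description of
  the presheaf lim Delta_n (along the right adjoints) without presheaves: since it is both the
  colimit along the left adjoints and the limit along the right adjoints, natural transformations
  out of it and into it are matrices. The rows and columns of the identity matrix at Delta form the
  colimiting cocone.
*)
theory Submission
  imports Defs
begin

section \<open>Chains and least upper bounds in an O-category\<close>

context category
begin

text \<open>The category axioms speak of hom-sets, whose middle object the simplifier would have to
  guess; with \<open>Dom\<close> and \<open>Cod\<close> the side conditions become equations that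
  rewriting settles.\<close>

lemma Cmp_Arr [simp]: "\<lbrakk>f \<in> Arr C; g \<in> Arr C; Cod C f = Dom C g\<rbrakk> \<Longrightarrow> g \<cdot> f \<in> Arr C"
  and Dom_Cmp [simp]: "\<lbrakk>f \<in> Arr C; g \<in> Arr C; Cod C f = Dom C g\<rbrakk> \<Longrightarrow> Dom C (g \<cdot> f) = Dom C f"
  and Cod_Cmp [simp]: "\<lbrakk>f \<in> Arr C; g \<in> Arr C; Cod C f = Dom C g\<rbrakk> \<Longrightarrow> Cod C (g \<cdot> f) = Cod C g"
  using Cmp_hom[of f "Dom C f" "Cod C f" g "Cod C g"] by (auto simp: hom_def)

lemma assoc [simp]:
  "\<lbrakk>f \<in> Arr C; g \<in> Arr C; h \<in> Arr C; Cod C f = Dom C g; Cod C g = Dom C h\<rbrakk>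
    \<Longrightarrow> (h \<cdot> g) \<cdot> f = h \<cdot> g \<cdot> f"
  using Cmp_assoc[of f "Dom C f" "Cod C f" g "Cod C g" h "Cod C h"] by (auto simp: hom_def)

lemma Ide_Arr [simp]: "A \<in> Obj C \<Longrightarrow> Ide C A \<in> Arr C"
  and Dom_Ide [simp]: "A \<in> Obj C \<Longrightarrow> Dom C (Ide C A) = A"
  and Cod_Ide [simp]: "A \<in> Obj C \<Longrightarrow> Cod C (Ide C A) = A"
  using Ide_hom[of A] by (auto simp: hom_def)

lemma Cmp_Ide_right [simp]: "\<lbrakk>f \<in> Arr C; Dom C f = A\<rbrakk> \<Longrightarrow> f \<cdot> Ide C A = f"
  and Cmp_Ide_left [simp]: "\<lbrakk>f \<in> Arr C; Cod C f = B\<rbrakk> \<Longrightarrow> Ide C B \<cdot> f = f"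
  using Cmp_Ide[of f "Dom C f" "Cod C f"] Ide_Cmp[of f "Dom C f" "Cod C f"]
  by (auto simp: hom_def)

lemmas [simp] = Dom_Obj Cod_Obj

end

text \<open>Brings the tail-indexed suprema of \<open>locally_determined\<close> into the form of a
  supremum over a sequence that starts at 0.\<close>

lemma Collect_ge_eq_range: "{f m | m. n \<le> m} = range (\<lambda>k. f (n + k))" for n :: nat
  by (auto simp: le_iff_add)

context O_category
begin

text \<open>Unlike \<open>Le\<close>, the relation \<open>le\<close> implies that its arguments are parallel arrows, so that it is
  transitive and antisymmetric without side conditions.\<close>

definition le :: "'b \<Rightarrow> 'b \<Rightarrow> bool" (infix "\<preceq>" 50) where
  "f \<preceq> g \<longleftrightarrow> f \<in> Arr K \<and> g \<in> Arr K \<and> Dom K f = Dom K g \<and> Cod K f = Cod K g \<and> f \<sqsubseteq> g"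

lemma le_refl [simp]: "f \<preceq> f \<longleftrightarrow> f \<in> Arr K"
  using Le_reflI[of f "Dom K f" "Cod K f"] by (auto simp: le_def hom_def)

lemma le_trans [trans]: "f \<preceq> g \<Longrightarrow> g \<preceq> h \<Longrightarrow> f \<preceq> h"
  using Le_transD[of f g h "Dom K f" "Cod K f"] by (auto simp: le_def hom_def)

lemma le_antisym: "f \<preceq> g \<Longrightarrow> g \<preceq> f \<Longrightarrow> f = g"
  using Le_antisym[of "Dom K f" "Cod K f"] unfolding le_def antisymp_on_def hom_def by auto

lemma le_parallel: "f \<preceq> g \<Longrightarrow> f \<in> Arr K \<and> g \<in> Arr K \<and> Dom K f = Dom K g \<and> Cod K f = Cod K g"
  by (simp add: le_def)

lemma le_iff_Le: "f \<in> hom K A B \<Longrightarrow> g \<in> hom K A B \<Longrightarrow> f \<preceq> g \<longleftrightarrow> f \<sqsubseteq> g"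
  by (auto simp: le_def hom_def)

lemma Cmp_le:
  "\<lbrakk>f \<preceq> f'; g \<preceq> g'; Cod K f = Dom K g\<rbrakk> \<Longrightarrow> g \<cdot> f \<preceq> g' \<cdot> f'"
  using Cmp_mono[of f "Dom K f" "Cod K f" f' g "Cod K g" g']
  by (auto simp: le_def hom_def)

lemma Cmp_le_right: "\<lbrakk>f \<preceq> f'; g \<in> Arr K; Cod K f = Dom K g\<rbrakk> \<Longrightarrow> g \<cdot> f \<preceq> g \<cdot> f'"
  and Cmp_le_left: "\<lbrakk>g \<preceq> g'; f \<in> Arr K; Cod K f = Dom K g\<rbrakk> \<Longrightarrow> g \<cdot> f \<preceq> g' \<cdot> f"
  by (auto intro: Cmp_le)

section \<open>Increasing sequences and their least upper bounds\<close>

definition chain :: "(nat \<Rightarrow> 'b) \<Rightarrow> bool" where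
  "chain u \<longleftrightarrow> (\<forall>n. u n \<preceq> u (Suc n))"

lemma chain_mono: "m \<le> n \<Longrightarrow> chain u \<Longrightarrow> u m \<preceq> u n"
  by (induction n rule: dec_induct) (auto simp: chain_def dest: le_parallel intro: le_trans)

lemma chain_Arr: "chain u \<Longrightarrow> u n \<in> Arr K"
  and chain_Dom: "chain u \<Longrightarrow> Dom K (u n) = Dom K (u 0)"
  and chain_Cod: "chain u \<Longrightarrow> Cod K (u n) = Cod K (u 0)"
  using chain_mono[of 0 n u] by (auto simp: le_parallel)

lemma increasing_iff_chain:
  "increasing K A B u \<longleftrightarrow> chain u \<and> Dom K (u 0) = A \<and> Cod K (u 0) = B"
proof
  assume "increasing K A B u"
  then show "chain u \<and> Dom K (u 0) = A \<and> Cod K (u 0) = B"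
    by (auto simp: increasing_def chain_def le_def hom_def)
next
  assume u: "chain u \<and> Dom K (u 0) = A \<and> Cod K (u 0) = B"
  then have "u n \<in> hom K A B" for n
    using chain_Arr[of u n] chain_Dom[of u n] chain_Cod[of u n] by (simp add: hom_def)
  then show "increasing K A B u"
    using u by (simp add: increasing_def chain_def le_def)
qed

lemma is_lub_unique: "is_lub K A B S s \<Longrightarrow> is_lub K A B S t \<Longrightarrow> s = t"
  by (intro le_antisym) (auto simp: is_lub_def le_def hom_def)

text \<open>All members of a chain are parallel, so the hom-set can be read off from
  \<open>u 0\<close>. The value is meaningful only for chains, where the supremum exists and is
  unique.\<close>

definition lub :: "(nat \<Rightarrow> 'b) \<Rightarrow> 'b" where
  "lub u = (THE s. is_lub K (Dom K (u 0)) (Cod K (u 0)) (range u) s)"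

lemma is_lub_lub: "chain u \<Longrightarrow> is_lub K (Dom K (u 0)) (Cod K (u 0)) (range u) (lub u)"
  unfolding lub_def
  by (rule theI') (use lub_exists[of _ _ u] is_lub_unique in \<open>auto simp: increasing_iff_chain\<close>)

lemma is_lub_iff:
  "chain u \<Longrightarrow> Dom K (u 0) = A \<Longrightarrow> Cod K (u 0) = B \<Longrightarrow> is_lub K A B (range u) s \<longleftrightarrow> s = lub u"
  using is_lub_lub is_lub_unique by blast

lemma lub_Arr [simp]: "chain u \<Longrightarrow> lub u \<in> Arr K"
  and Dom_lub [simp]: "chain u \<Longrightarrow> Dom K (lub u) = Dom K (u 0)"
  and Cod_lub [simp]: "chain u \<Longrightarrow> Cod K (lub u) = Cod K (u 0)"
  using is_lub_lub[of u] by (auto simp: is_lub_def hom_def)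

lemma lub_upper: "chain u \<Longrightarrow> u n \<preceq> lub u"
  using is_lub_lub[of u] chain_Dom[of u n] chain_Cod[of u n] chain_Arr[of u n]
  by (auto simp: is_lub_def hom_def le_def)

lemma le_lub: "chain u \<Longrightarrow> f \<preceq> u n \<Longrightarrow> f \<preceq> lub u"
  using lub_upper le_trans by blast

lemma lub_least:
  assumes u: "chain u" and t: "\<And>n. u n \<preceq> t"
  shows "lub u \<preceq> t"
proof -
  have "t \<in> hom K (Dom K (u 0)) (Cod K (u 0))" "\<And>n. u n \<sqsubseteq> t"
    using t by (simp_all add: le_def hom_def)
  then have "lub u \<sqsubseteq> t" "lub u \<in> hom K (Dom K (u 0)) (Cod K (u 0))"
    using is_lub_lub[OF u] by (auto simp: is_lub_def)
  then show ?thesis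
    using t[of 0] by (simp add: le_def hom_def)
qed

text \<open>Cofinality is enough, which allows chains that start at different stages to be
  compared.\<close>

lemma lub_mono: "chain u \<Longrightarrow> chain v \<Longrightarrow> (\<And>n. \<exists>m. u n \<preceq> v m) \<Longrightarrow> lub u \<preceq> lub v"
  by (meson lub_least le_lub)

lemma chain_const [simp]: "chain (\<lambda>_. f) \<longleftrightarrow> f \<in> Arr K"
  by (simp add: chain_def)

lemma lub_const [simp]: "f \<in> Arr K \<Longrightarrow> lub (\<lambda>_. f) = f"
  by (rule le_antisym) (auto intro: lub_least le_lub)

lemma chain_Cmp_right:
  assumes "chain u" "g \<in> Arr K" "Cod K (u 0) = Dom K g"
  shows "chain (\<lambda>n. g \<cdot> u n)"
  unfolding chain_def
proof
  fix n
  show "g \<cdot> u n \<preceq> g \<cdot> u (Suc n)"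
    using assms chain_Cod[of u n] by (auto simp: chain_def intro: Cmp_le_right)
qed

lemma chain_Cmp_left:
  assumes "chain u" "f \<in> Arr K" "Cod K f = Dom K (u 0)"
  shows "chain (\<lambda>n. u n \<cdot> f)"
  unfolding chain_def
proof
  fix n
  show "u n \<cdot> f \<preceq> u (Suc n) \<cdot> f"
    using assms chain_Dom[of u n] by (auto simp: chain_def intro: Cmp_le_left)
qed

lemma Cmp_lub: "\<lbrakk>chain u; g \<in> Arr K; Cod K (u 0) = Dom K g\<rbrakk> \<Longrightarrow> g \<cdot> lub u = lub (\<lambda>n. g \<cdot> u n)"
  using Cmp_lub_right[of "Dom K (u 0)" "Cod K (u 0)" u "lub u" g "Cod K g"]
    is_lub_lub[of u] is_lub_iff[OF chain_Cmp_right[of u g] refl refl] chain_Arr[of u 0]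
  by (simp add: increasing_iff_chain hom_def)

lemma lub_Cmp: "\<lbrakk>chain u; f \<in> Arr K; Cod K f = Dom K (u 0)\<rbrakk> \<Longrightarrow> lub u \<cdot> f = lub (\<lambda>n. u n \<cdot> f)"
  using Cmp_lub_left[of "Dom K (u 0)" "Cod K (u 0)" u "lub u" f "Dom K f"]
    is_lub_lub[of u] is_lub_iff[OF chain_Cmp_left[of u f] refl refl] chain_Arr[of u 0]
  by (simp add: increasing_iff_chain hom_def)

lemma chain_lub:
  assumes "\<And>k. chain (w k)" and "\<And>k p. w k p \<preceq> w (Suc k) p"
  shows "chain (\<lambda>k. lub (w k))"
  unfolding chain_def using assms by (blast intro: lub_mono)

text \<open>Either iterated supremum is the supremum of the whole double family \<open>w\<close>,
  since every single entry lies below both of them.\<close>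

lemma lub_swap:
  assumes "\<And>k. chain (w k)" and "\<And>p. chain (\<lambda>k. w k p)"
  shows "lub (\<lambda>k. lub (w k)) = lub (\<lambda>p. lub (\<lambda>k. w k p))"
proof -
  have row: "chain (\<lambda>k. lub (w k))" and col: "chain (\<lambda>p. lub (\<lambda>k. w k p))"
    using assms chain_lub[of w] chain_lub[of "\<lambda>p k. w k p"] unfolding chain_def by blast+
  show ?thesis
  proof (intro le_antisym lub_least row col assms)
    fix k p
    show "w k p \<preceq> lub (\<lambda>p. lub (\<lambda>k. w k p))"
      using lub_upper[OF assms(2)] by (rule le_lub[OF col])
    show "w p k \<preceq> lub (\<lambda>k. lub (w k))"
      using lub_upper[OF assms(1)] by (rule le_lub[OF row])
  qed
qed

subsection \<open>Adjoint pairs and their cocones\<close>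

text \<open>The halves of an adjoint pair are separate arguments, so that a chain or cocone becomes
  two families of arrows of \<open>K\<close> that can be computed with directly.\<close>

definition adjoint :: "'a \<Rightarrow> 'a \<Rightarrow> 'b \<Rightarrow> 'b \<Rightarrow> bool" where
  "adjoint A B l r \<longleftrightarrow> A \<in> Obj K \<and> B \<in> Obj K \<and> l \<in> Arr K \<and> Dom K l = A \<and> Cod K l = B \<and>
    r \<in> Arr K \<and> Dom K r = B \<and> Cod K r = A \<and> l \<cdot> r \<preceq> Ide K B \<and> Ide K A \<preceq> r \<cdot> l"

lemma hom_Adj_iff: "f \<in> hom (Adj K) A B \<longleftrightarrow> adjoint A B (fst f) (snd f)"
  by (cases f) (auto simp: Adj_def adjoint_def le_def hom_def)

lemma Cmp_Adj: "g \<cdot>\<^bsub>Adj K\<^esub> f = (fst g \<cdot> fst f, snd f \<cdot> snd g)"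
  by (simp add: Adj_def)

text \<open>A functor from \<open>omega\<close> to \<open>Adj K\<close> in components:
  \<open>l\<close> goes up the chain and \<open>r\<close> comes down. The conditions concern only
  \<open>n \<le> m\<close>, which is why later facts carry index bounds.\<close>

definition adjoint_chain :: "(nat \<Rightarrow> 'a) \<Rightarrow> (nat \<Rightarrow> nat \<Rightarrow> 'b) \<Rightarrow> (nat \<Rightarrow> nat \<Rightarrow> 'b) \<Rightarrow> bool" where
  "adjoint_chain D l r \<longleftrightarrow>
    (\<forall>n m. n \<le> m \<longrightarrow> adjoint (D n) (D m) (l n m) (r n m)) \<and>
    (\<forall>n. l n n = Ide K (D n) \<and> r n n = Ide K (D n)) \<and>
    (\<forall>n m k. n \<le> m \<longrightarrow> m \<le> k \<longrightarrow> l m k \<cdot> l n m = l n k \<and> r n m \<cdot> r m k = r n k)"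

definition adjoint_cocone ::
  "(nat \<Rightarrow> 'a) \<Rightarrow> (nat \<Rightarrow> nat \<Rightarrow> 'b) \<Rightarrow> (nat \<Rightarrow> nat \<Rightarrow> 'b) \<Rightarrow> 'a \<Rightarrow> (nat \<Rightarrow> 'b) \<Rightarrow> (nat \<Rightarrow> 'b) \<Rightarrow> bool"
  where
  "adjoint_cocone D l r X a b \<longleftrightarrow>
    (\<forall>n. adjoint (D n) X (a n) (b n)) \<and>
    (\<forall>n m. n \<le> m \<longrightarrow> a m \<cdot> l n m = a n \<and> r n m \<cdot> b m = b n)"

lemma adjoint_chain_functor:
  assumes "is_functor omega (Adj K) \<Delta>"
  shows "adjoint_chain (fobj \<Delta>) (\<lambda>n m. fst (farr \<Delta> (n, m))) (\<lambda>n m. snd (farr \<Delta> (n, m)))"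
proof -
  have arr: "\<And>f A B. f \<in> hom omega A B \<Longrightarrow> farr \<Delta> f \<in> hom (Adj K) (fobj \<Delta> A) (fobj \<Delta> B)"
    and ide: "\<And>n. farr \<Delta> (Ide omega n) = Ide (Adj K) (fobj \<Delta> n)"
    and cmp: "\<And>f g. \<lbrakk>f \<in> Arr omega; g \<in> Arr omega; Cod omega f = Dom omega g\<rbrakk>
      \<Longrightarrow> farr \<Delta> (g \<cdot>\<^bsub>omega\<^esub> f) = farr \<Delta> g \<cdot>\<^bsub>Adj K\<^esub> farr \<Delta> f"
    using assms category.hom_Obj[OF category_omega] unfolding is_functor_def
    by (blast, simp add: omega_def, blast)
  have 1: "farr \<Delta> (n, m) \<in> hom (Adj K) (fobj \<Delta> n) (fobj \<Delta> m)" if "n \<le> m" for n m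
    using that by (intro arr) (simp add: omega_def hom_def)
  have 2: "farr \<Delta> (n, n) = (Ide K (fobj \<Delta> n), Ide K (fobj \<Delta> n))" for n
    using ide[of n] by (simp add: omega_def)
  have 3: "farr \<Delta> (n, k) = farr \<Delta> (m, k) \<cdot>\<^bsub>Adj K\<^esub> farr \<Delta> (n, m)" if "n \<le> m" "m \<le> k" for n m k
    using cmp[of "(n, m)" "(m, k)"] that by (simp add: omega_def)
  show ?thesis
    unfolding adjoint_chain_def
  proof (intro conjI allI impI)
    fix n m k :: nat
    assume nm: "n \<le> m"
    show "adjoint (fobj \<Delta> n) (fobj \<Delta> m) (fst (farr \<Delta> (n, m))) (snd (farr \<Delta> (n, m)))"
      using 1[OF nm] by (simp add: hom_Adj_iff)
    assume mk: "m \<le> k"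
    show "fst (farr \<Delta> (m, k)) \<cdot> fst (farr \<Delta> (n, m)) = fst (farr \<Delta> (n, k))"
      "snd (farr \<Delta> (n, m)) \<cdot> snd (farr \<Delta> (m, k)) = snd (farr \<Delta> (n, k))"
      unfolding 3[OF nm mk] by (simp_all add: Adj_def)
  qed (simp_all add: 2)
qed

lemma is_cocone_Adj_iff:
  "is_cocone (Adj K) \<Delta> X c \<longleftrightarrow> adjoint_cocone (fobj \<Delta>) (\<lambda>n m. fst (farr \<Delta> (n, m)))
    (\<lambda>n m. snd (farr \<Delta> (n, m))) X (\<lambda>n. fst (c n)) (\<lambda>n. snd (c n))"
  by (auto simp: is_cocone_def adjoint_cocone_def hom_Adj_iff Cmp_Adj prod_eq_iff)
    (simp add: adjoint_def)

lemma adjointD: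
  assumes "adjoint A B l r"
  shows "A \<in> Obj K" "B \<in> Obj K" "l \<in> Arr K" "Dom K l = A" "Cod K l = B"
    "r \<in> Arr K" "Dom K r = B" "Cod K r = A"
  using assms by (auto simp: adjoint_def)

lemma adjoint_counit:
  assumes "adjoint A B l r" "f \<in> Arr K" "Cod K f = B"
  shows "l \<cdot> r \<cdot> f \<preceq> f"
proof -
  note [simp] = adjointD[OF assms(1)]
  have "(l \<cdot> r) \<cdot> f \<preceq> Ide K B \<cdot> f"
    using assms by (intro Cmp_le_left) (simp_all add: adjoint_def)
  then show ?thesis using assms(2,3) by simp
qed

lemma adjoint_unit:
  assumes "adjoint A B l r" "f \<in> Arr K" "Cod K f = A"
  shows "f \<preceq> r \<cdot> l \<cdot> f"
proof -
  note [simp] = adjointD[OF assms(1)]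
  have "Ide K A \<cdot> f \<preceq> (r \<cdot> l) \<cdot> f"
    using assms by (intro Cmp_le_left) (simp_all add: adjoint_def)
  then show ?thesis using assms(2,3) by simp
qed

lemma adjoint_chain_adjoint: "adjoint_chain D l r \<Longrightarrow> n \<le> m \<Longrightarrow> adjoint (D n) (D m) (l n m) (r n m)"
  by (simp add: adjoint_chain_def)

lemma adjoint_chainD:
  assumes "adjoint_chain D l r"
  shows "D n \<in> Obj K"
    "n \<le> m \<Longrightarrow> l n m \<in> Arr K" "n \<le> m \<Longrightarrow> Dom K (l n m) = D n" "n \<le> m \<Longrightarrow> Cod K (l n m) = D m"
    "n \<le> m \<Longrightarrow> r n m \<in> Arr K" "n \<le> m \<Longrightarrow> Dom K (r n m) = D m" "n \<le> m \<Longrightarrow> Cod K (r n m) = D n"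
    "l n n = Ide K (D n)" "r n n = Ide K (D n)"
  using assms by (auto simp: adjoint_chain_def adjoint_def)

text \<open>The last two claims are functoriality in front of a further arrow: once
  \<open>assoc\<close> has associated to the right, the composite of two chain maps no longer occurs
  as a subterm.\<close>

lemma adjoint_chain_Cmp:
  assumes "adjoint_chain D l r" "n \<le> m" "m \<le> k"
  shows "l m k \<cdot> l n m = l n k" "r n m \<cdot> r m k = r n k"
    "\<lbrakk>f \<in> Arr K; Cod K f = D n\<rbrakk> \<Longrightarrow> l m k \<cdot> l n m \<cdot> f = l n k \<cdot> f"
    "\<lbrakk>f \<in> Arr K; Cod K f = D k\<rbrakk> \<Longrightarrow> r n m \<cdot> r m k \<cdot> f = r n k \<cdot> f"
proof -
  show 1: "l m k \<cdot> l n m = l n k" "r n m \<cdot> r m k = r n k"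
    using assms by (auto simp: adjoint_chain_def)
  note [simp] = adjoint_chainD[OF assms(1)]
  show "l m k \<cdot> l n m \<cdot> f = l n k \<cdot> f" if "f \<in> Arr K" "Cod K f = D n"
    using assms that by (simp flip: 1(1))
  show "r n m \<cdot> r m k \<cdot> f = r n k \<cdot> f" if "f \<in> Arr K" "Cod K f = D k"
    using assms that by (simp flip: 1(2))
qed

lemma adjoint_coconeD:
  assumes "adjoint_cocone D l r X a b"
  shows "adjoint (D n) X (a n) (b n)"
    "X \<in> Obj K" "a n \<in> Arr K" "Dom K (a n) = D n" "Cod K (a n) = X"
    "b n \<in> Arr K" "Dom K (b n) = X" "Cod K (b n) = D n"
    "n \<le> m \<Longrightarrow> a m \<cdot> l n m = a n" "n \<le> m \<Longrightarrow> r n m \<cdot> b m = b n"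
  using assms by (auto simp: adjoint_cocone_def adjoint_def)

text \<open>Going one stage higher inserts a composite \<open>r \<cdot> l\<close> between the two
  factors, and the unit says that this increases the arrow. The start \<open>N\<close> may be any
  common bound of the two indices.\<close>

lemma chain_right_left:
  assumes C: "adjoint_chain D l r" and "m \<le> N" "n \<le> N"
  shows "chain (\<lambda>k. r m (N + k) \<cdot> l n (N + k))"
  unfolding chain_def
proof
  fix k
  let ?p = "N + k"
  note [simp] = adjoint_chainD[OF C]
  have "r m ?p \<cdot> l n ?p \<preceq> r m ?p \<cdot> r ?p (Suc ?p) \<cdot> l ?p (Suc ?p) \<cdot> l n ?p"
    using assms by (intro Cmp_le_right adjoint_unit[OF adjoint_chain_adjoint[OF C]]) auto
  also have "\<dots> = r m (Suc ?p) \<cdot> l n (Suc ?p)"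
    using assms by (simp add: adjoint_chain_Cmp[OF C])
  finally show "r m ?p \<cdot> l n ?p \<preceq> r m (N + Suc k) \<cdot> l n (N + Suc k)" by simp
qed

text \<open>Factoring both arrows through stage \<open>Suc n\<close> leaves
  \<open>l \<cdot> r\<close> between them, which the counit removes. Taking the two cocones equal
  gives the sequence in the first condition of local determinedness.\<close>

lemma chain_cocones:
  assumes C: "adjoint_chain D l r"
    and X: "adjoint_cocone D l r X a b" and Y: "adjoint_cocone D l r Y a' b'"
  shows "chain (\<lambda>n. a' n \<cdot> b n)"
  unfolding chain_def
proof
  fix n
  note [simp] = adjoint_chainD[OF C] adjoint_coconeD(2-8)[OF X] adjoint_coconeD(2-8)[OF Y]
  have "a' n \<cdot> b n = (a' (Suc n) \<cdot> l n (Suc n)) \<cdot> (r n (Suc n) \<cdot> b (Suc n))"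
    using adjoint_coconeD(9,10)[OF X, of n "Suc n"] adjoint_coconeD(9,10)[OF Y, of n "Suc n"] by simp
  also have "\<dots> = a' (Suc n) \<cdot> l n (Suc n) \<cdot> r n (Suc n) \<cdot> b (Suc n)"
    by simp
  also have "\<dots> \<preceq> a' (Suc n) \<cdot> b (Suc n)"
    by (intro Cmp_le_right adjoint_counit[OF adjoint_chain_adjoint[OF C]]) auto
  finally show "a' n \<cdot> b n \<preceq> a' (Suc n) \<cdot> b (Suc n)" .
qed

text \<open>For \<open>p \<ge> n\<close>, \<open>det\<close> rewrites \<open>b p \<cdot> a p\<close>
  as the supremum of the arrows \<open>r p q \<cdot> l p q\<close>. Factoring \<open>a' p\<close> as
  \<open>a' q \<cdot> l p q\<close> exposes a counit, so every term is at most \<open>a' n\<close>;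
  the unit of the pair \<open>a n\<close>, \<open>b n\<close> makes the term at \<open>n\<close> at
  least \<open>a' n\<close>. The claim about \<open>b n\<close> is dual.\<close>

lemma mediating_cocone:
  assumes C: "adjoint_chain D l r"
    and X: "adjoint_cocone D l r X a b" and Y: "adjoint_cocone D l r Y a' b'"
    and det: "\<And>n. lub (\<lambda>k. r n (n + k) \<cdot> l n (n + k)) = b n \<cdot> a n"
  shows "lub (\<lambda>n. a' n \<cdot> b n) \<cdot> a n = a' n"
    and "b n \<cdot> lub (\<lambda>n. a n \<cdot> b' n) = b' n"
proof -
  note [simp] = adjoint_chainD[OF C] adjoint_coconeD(2-8)[OF X] adjoint_coconeD(2-8)[OF Y]
  note ch = chain_cocones[OF C X Y] chain_cocones[OF C Y X] chain_right_left[OF C]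
  have ch': "chain (\<lambda>m. a' m \<cdot> b m \<cdot> a n)" "chain (\<lambda>m. b n \<cdot> a m \<cdot> b' m)"
    using chain_Cmp_left[OF ch(1), of "a n"] chain_Cmp_right[OF ch(2), of "b n"] by simp_all
  have 1: "lub (\<lambda>n. a' n \<cdot> b n) \<cdot> a n = lub (\<lambda>m. a' m \<cdot> b m \<cdot> a n)"
    using lub_Cmp[OF ch(1), of "a n"] by simp
  have 2: "b n \<cdot> lub (\<lambda>n. a n \<cdot> b' n) = lub (\<lambda>m. b n \<cdot> a m \<cdot> b' m)"
    using Cmp_lub[OF ch(2), of "b n"] by simp
  have A: "a' p \<cdot> b p \<cdot> a n \<preceq> a' n" if "n \<le> p" for p
  proof -
    let ?u = "\<lambda>k. r p (p + k) \<cdot> l p (p + k)"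
    have chu: "chain ?u" by (intro ch) auto
    \<comment> \<open>Factoring \<open>a n\<close> through stage \<open>p\<close> creates the
      composite \<open>b p \<cdot> a p\<close> to which \<open>det\<close> applies.\<close>
    have "a' p \<cdot> b p \<cdot> a n = a' p \<cdot> (b p \<cdot> a p) \<cdot> l n p"
      using that adjoint_coconeD(9)[OF X, of n p] by simp
    also have "\<dots> = a' p \<cdot> lub ?u \<cdot> l n p"
      by (simp only: det)
    also have "\<dots> = lub (\<lambda>k. a' p \<cdot> ?u k \<cdot> l n p)"
      using that chu by (simp add: lub_Cmp Cmp_lub chain_Cmp_left del: assoc)
    also have "\<dots> \<preceq> a' n"
    proof (rule lub_least)
      show "chain (\<lambda>k. a' p \<cdot> ?u k \<cdot> l n p)"
        using that chu by (intro chain_Cmp_right chain_Cmp_left) auto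
      fix k
      let ?q = "p + k"
      have "a' p \<cdot> ?u k \<cdot> l n p = (a' ?q \<cdot> l p ?q) \<cdot> ?u k \<cdot> l n p"
        using adjoint_coconeD(9)[OF Y, of p ?q] by simp
      also have "\<dots> = a' ?q \<cdot> l p ?q \<cdot> r p ?q \<cdot> l n ?q"
        using that by (simp add: adjoint_chain_Cmp[OF C])
      also have "\<dots> \<preceq> a' ?q \<cdot> l n ?q"
        using that by (intro Cmp_le_right adjoint_counit[OF adjoint_chain_adjoint[OF C]]) auto
      also have "\<dots> = a' n"
        using that by (intro adjoint_coconeD(9)[OF Y]) simp
      finally show "a' p \<cdot> ?u k \<cdot> l n p \<preceq> a' n" .
    qed
    finally show ?thesis .
  qed
  have B: "b n \<cdot> a p \<cdot> b' p \<preceq> b' n" if "n \<le> p" for p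
  proof -
    let ?u = "\<lambda>k. r p (p + k) \<cdot> l p (p + k)"
    have chu: "chain ?u" by (intro ch) auto
    have "b n \<cdot> a p \<cdot> b' p = r n p \<cdot> (b p \<cdot> a p) \<cdot> b' p"
      using that adjoint_coconeD(10)[OF X, of n p] by (simp flip: assoc)
    also have "\<dots> = r n p \<cdot> lub ?u \<cdot> b' p"
      by (simp only: det)
    also have "\<dots> = lub (\<lambda>k. r n p \<cdot> ?u k \<cdot> b' p)"
      using that chu by (simp add: lub_Cmp Cmp_lub chain_Cmp_left del: assoc)
    also have "\<dots> \<preceq> b' n"
    proof (rule lub_least)
      show "chain (\<lambda>k. r n p \<cdot> ?u k \<cdot> b' p)"
        using that chu by (intro chain_Cmp_right chain_Cmp_left) auto
      fix k
      let ?q = "p + k"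
      have "r n p \<cdot> ?u k \<cdot> b' p = r n p \<cdot> ?u k \<cdot> r p ?q \<cdot> b' ?q"
        using adjoint_coconeD(10)[OF Y, of p ?q] by simp
      also have "\<dots> = r n ?q \<cdot> l p ?q \<cdot> r p ?q \<cdot> b' ?q"
        using that by (simp add: adjoint_chain_Cmp[OF C])
      also have "\<dots> \<preceq> r n ?q \<cdot> b' ?q"
        using that by (intro Cmp_le_right adjoint_counit[OF adjoint_chain_adjoint[OF C]]) auto
      also have "\<dots> = b' n"
        using that by (intro adjoint_coconeD(10)[OF Y]) simp
      finally show "r n p \<cdot> ?u k \<cdot> b' p \<preceq> b' n" .
    qed
    finally show ?thesis .
  qed
  show "lub (\<lambda>n. a' n \<cdot> b n) \<cdot> a n = a' n"
    unfolding 1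
  proof (rule le_antisym)
    \<comment> \<open>\<open>A\<close> covers only indices from \<open>n\<close> on; an arbitrary
      term \<open>m\<close> is first raised to the term \<open>m + n\<close>.\<close>
    show "lub (\<lambda>m. a' m \<cdot> b m \<cdot> a n) \<preceq> a' n"
      using chain_mono[OF _ ch'(1), of _ "_ + n"] A[of "_ + n"]
      by (blast intro: lub_least[OF ch'(1)] le_trans le_add1 le_add2)
    have "a' n \<cdot> Ide K (D n) \<preceq> a' n \<cdot> b n \<cdot> a n"
      using adjoint_coconeD(1)[OF X, of n] by (intro Cmp_le_right) (auto simp: adjoint_def)
    then show "a' n \<preceq> lub (\<lambda>m. a' m \<cdot> b m \<cdot> a n)"
      by (intro le_lub[OF ch'(1)]) simp
  qed
  show "b n \<cdot> lub (\<lambda>n. a n \<cdot> b' n) = b' n"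
    unfolding 2
  proof (rule le_antisym)
    show "lub (\<lambda>m. b n \<cdot> a m \<cdot> b' m) \<preceq> b' n"
      using chain_mono[OF _ ch'(2), of _ "_ + n"] B[of "_ + n"]
      by (blast intro: lub_least[OF ch'(2)] le_trans le_add1 le_add2)
    show "b' n \<preceq> lub (\<lambda>m. b n \<cdot> a m \<cdot> b' m)"
      by (intro le_lub[OF ch'(2), where n = n] adjoint_unit[OF adjoint_coconeD(1)[OF X]]) auto
  qed
qed

text \<open>The counit is checked on each term of the right arrow: the left arrow after
  \<open>a n\<close> is \<open>a' n\<close>, so the counit of the pair \<open>a' n\<close>,
  \<open>b' n\<close> applies. For the unit, \<open>top\<close> reduces the identity to the arrows
  \<open>a n \<cdot> b n\<close>, and the unit of that pair puts each of them below the composite of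
  the two suprema.\<close>

lemma mediating_adjoint:
  assumes C: "adjoint_chain D l r"
    and X: "adjoint_cocone D l r X a b" and Y: "adjoint_cocone D l r Y a' b'"
    and top: "lub (\<lambda>n. a n \<cdot> b n) = Ide K X"
    and det: "\<And>n. lub (\<lambda>k. r n (n + k) \<cdot> l n (n + k)) = b n \<cdot> a n"
  shows "adjoint X Y (lub (\<lambda>n. a' n \<cdot> b n)) (lub (\<lambda>n. a n \<cdot> b' n))"
proof -
  note [simp] = adjoint_chainD[OF C] adjoint_coconeD(2-8)[OF X] adjoint_coconeD(2-8)[OF Y]
  note ch = chain_cocones[OF C X Y] chain_cocones[OF C Y X] chain_cocones[OF C X X]
  let ?H = "lub (\<lambda>n. a' n \<cdot> b n)" and ?R = "lub (\<lambda>n. a n \<cdot> b' n)"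
  note H = mediating_cocone[OF C X Y det]
  have hr [simp]: "?H \<in> Arr K" "Dom K ?H = X" "Cod K ?H = Y" "?R \<in> Arr K" "Dom K ?R = Y" "Cod K ?R = X"
    using ch by simp_all
  have 1: "?H \<cdot> a n \<cdot> b' n \<preceq> Ide K Y" for n
  proof -
    have "?H \<cdot> a n \<cdot> b' n = (?H \<cdot> a n) \<cdot> b' n"
      by (intro assoc[symmetric]) simp_all
    then show ?thesis
      using adjoint_coconeD(1)[OF Y, of n] by (simp add: H adjoint_def)
  qed
  have 2: "a n \<cdot> b n \<preceq> ?R \<cdot> ?H" for n
  proof -
    have "a n \<cdot> b n \<preceq> a n \<cdot> b' n \<cdot> a' n \<cdot> b n"
      by (intro Cmp_le_right adjoint_unit[OF adjoint_coconeD(1)[OF Y]]) simp_all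
    also have "\<dots> = (a n \<cdot> b' n) \<cdot> (a' n \<cdot> b n)"
      by simp
    also have "\<dots> \<preceq> ?R \<cdot> ?H"
      by (intro Cmp_le lub_upper ch) simp_all
    finally show ?thesis .
  qed
  have "?H \<cdot> ?R \<preceq> Ide K Y"
  proof -
    have "?H \<cdot> ?R = lub (\<lambda>n. ?H \<cdot> a n \<cdot> b' n)"
      by (intro Cmp_lub ch) simp_all
    also have "\<dots> \<preceq> Ide K Y"
      by (intro lub_least chain_Cmp_right ch 1) simp_all
    finally show ?thesis .
  qed
  moreover have "Ide K X \<preceq> ?R \<cdot> ?H"
    unfolding top[symmetric] by (intro lub_least ch 2)
  ultimately show ?thesis
    by (simp add: adjoint_def)
qed

section \<open>Local determinedness, the colimit property and invariance under isomorphism\<close>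

lemma locally_determined_iff:
  assumes "is_functor omega (Adj K) \<Delta>" and "is_cocone (Adj K) \<Delta> X c"
  shows "locally_determined K \<Delta> X c \<longleftrightarrow>
    lub (\<lambda>n. fst (c n) \<cdot> snd (c n)) = Ide K X \<and>
    (\<forall>n. lub (\<lambda>k. snd (farr \<Delta> (n, n + k)) \<cdot> fst (farr \<Delta> (n, n + k))) = snd (c n) \<cdot> fst (c n))"
proof -
  note C = adjoint_chain_functor[OF assms(1)] and X = assms(2)[unfolded is_cocone_Adj_iff]
  note [simp] = adjoint_chainD[OF C] adjoint_coconeD(2-8)[OF X]
  have 1: "{fst (c n) \<cdot> snd (c n) | n. True} = range (\<lambda>n. fst (c n) \<cdot> snd (c n))"
    by auto
  have 2: "{snd (farr \<Delta> (n, m)) \<cdot> fst (farr \<Delta> (n, m)) | m. n \<le> m}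
    = range (\<lambda>k. snd (farr \<Delta> (n, n + k)) \<cdot> fst (farr \<Delta> (n, n + k)))" for n
    by (rule Collect_ge_eq_range)
  have 3: "is_lub K X X (range (\<lambda>n. fst (c n) \<cdot> snd (c n))) s \<longleftrightarrow> s = lub (\<lambda>n. fst (c n) \<cdot> snd (c n))" for s
    by (intro is_lub_iff chain_cocones[OF C X X]) simp_all
  have 4: "is_lub K (fobj \<Delta> n) (fobj \<Delta> n)
      (range (\<lambda>k. snd (farr \<Delta> (n, n + k)) \<cdot> fst (farr \<Delta> (n, n + k)))) s
    \<longleftrightarrow> s = lub (\<lambda>k. snd (farr \<Delta> (n, n + k)) \<cdot> fst (farr \<Delta> (n, n + k)))" for n s
    by (intro is_lub_iff chain_right_left[OF C]) simp_all
  show ?thesis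
    unfolding locally_determined_def 1 2 3 4 by auto
qed

lemma locally_determined_colimiting:
  assumes \<Delta>: "is_functor omega (Adj K) \<Delta>" and c: "is_cocone (Adj K) \<Delta> X c"
    and ld: "locally_determined K \<Delta> X c"
  shows "is_colimiting (Adj K) \<Delta> X c"
  unfolding is_colimiting_def
proof (intro conjI allI impI c)
  fix Y d
  assume d: "is_cocone (Adj K) \<Delta> Y d"
  note C = adjoint_chain_functor[OF \<Delta>] and X = c[unfolded is_cocone_Adj_iff]
    and Y = d[unfolded is_cocone_Adj_iff]
  have top: "lub (\<lambda>n. fst (c n) \<cdot> snd (c n)) = Ide K X"
    and det: "\<And>n. lub (\<lambda>k. snd (farr \<Delta> (n, n + k)) \<cdot> fst (farr \<Delta> (n, n + k))) = snd (c n) \<cdot> fst (c n)"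
    using ld by (auto simp: locally_determined_iff[OF \<Delta> c])
  let ?h = "(lub (\<lambda>n. fst (d n) \<cdot> snd (c n)), lub (\<lambda>n. fst (c n) \<cdot> snd (d n)))"
  show "\<exists>!h. h \<in> hom (Adj K) X Y \<and> (\<forall>n. h \<cdot>\<^bsub>Adj K\<^esub> c n = d n)"
  proof (rule ex1I[of _ ?h])
    show "?h \<in> hom (Adj K) X Y \<and> (\<forall>n. ?h \<cdot>\<^bsub>Adj K\<^esub> c n = d n)"
      using mediating_adjoint[OF C X Y top det] mediating_cocone[OF C X Y det]
      by (simp add: hom_Adj_iff Cmp_Adj)
  next
    fix h
    assume h: "h \<in> hom (Adj K) X Y \<and> (\<forall>n. h \<cdot>\<^bsub>Adj K\<^esub> c n = d n)"
    then have hd: "\<And>n. fst (d n) = fst h \<cdot> fst (c n)" "\<And>n. snd (d n) = snd (c n) \<cdot> snd h"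
      by (metis Cmp_Adj fst_conv, metis Cmp_Adj snd_conv)
    have "adjoint X Y (fst h) (snd h)"
      using h by (simp add: hom_Adj_iff)
    note [simp] = adjointD[OF this] adjoint_coconeD(2-8)[OF X]
    have ch: "chain (\<lambda>n. fst (c n) \<cdot> snd (c n))"
      by (rule chain_cocones[OF C X X])
    \<comment> \<open>Uniqueness: the supremum in \<open>top\<close> is the identity, so
      distributing \<open>h\<close> over it expresses each half of \<open>h\<close> through
      \<open>c\<close> and \<open>d\<close> alone.\<close>
    have "fst h \<cdot> lub (\<lambda>n. fst (c n) \<cdot> snd (c n)) = lub (\<lambda>n. fst (d n) \<cdot> snd (c n))"
      "lub (\<lambda>n. fst (c n) \<cdot> snd (c n)) \<cdot> snd h = lub (\<lambda>n. fst (c n) \<cdot> snd (d n))"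
      by (simp_all add: Cmp_lub[OF ch] lub_Cmp[OF ch] hd)
    then show "h = ?h"
      by (simp add: top prod_eq_iff)
  qed
qed

text \<open>The counit gives \<open>r = l' \<cdot> l \<cdot> r \<preceq> l'\<close> and the unit
  gives \<open>l' \<preceq> r \<cdot> l \<cdot> l' = r\<close>. So the right half of an isomorphism
  in \<open>Adj K\<close> is the inverse of its left half.\<close>

lemma adjoint_iso:
  assumes "adjoint X Y l r" "adjoint Y X l' r'" "l' \<cdot> l = Ide K X" "l \<cdot> l' = Ide K Y"
  shows "r = l'"
proof (rule le_antisym)
  note [simp] = adjointD[OF assms(1)] adjointD[OF assms(2)]
  have "r = l' \<cdot> l \<cdot> r"
    using assms(3) by (simp flip: assoc)
  also have "\<dots> \<preceq> l' \<cdot> Ide K Y"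
    using assms(1) by (intro Cmp_le_right) (simp_all add: adjoint_def)
  finally show "r \<preceq> l'"
    by simp
  show "l' \<preceq> r"
    using adjoint_unit[OF assms(1), of l'] assms(4) by simp
qed

text \<open>Two colimits of a chain are isomorphic, and the right half of the isomorphism
  \<open>h\<close> is the left half of its inverse \<open>g\<close>. In
  \<open>snd (d n) \<cdot> fst (d n)\<close> the two cancel; in
  \<open>fst (d n) \<cdot> snd (d n)\<close> they stand outside and can be pulled out of the
  supremum.\<close>

lemma locally_determined_iso:
  assumes \<Delta>: "is_functor omega (Adj K) \<Delta>" and X: "is_colimiting (Adj K) \<Delta> X c"
    and ld: "locally_determined K \<Delta> X c" and Y: "is_colimiting (Adj K) \<Delta> Y d"
  shows "locally_determined K \<Delta> Y d"
proof -
  have Xc: "is_cocone (Adj K) \<Delta> X c" and Yc: "is_cocone (Adj K) \<Delta> Y d"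
    using X Y by (auto simp: is_colimiting_def)
  obtain h where h: "h \<in> hom (Adj K) X Y" "\<And>n. h \<cdot>\<^bsub>Adj K\<^esub> c n = d n"
    using X Yc unfolding is_colimiting_def by blast
  obtain g where g: "g \<in> hom (Adj K) Y X" "\<And>n. g \<cdot>\<^bsub>Adj K\<^esub> d n = c n"
    using Y Xc unfolding is_colimiting_def by blast
  interpret A: category "Adj K" by (rule category_Adj)
  \<comment> \<open>An endomorphism that fixes a colimiting cocone is the identity; this is used for
    both composites of \<open>g\<close> and \<open>h\<close>.\<close>
  have endo: "e = Ide (Adj K) Z"
    if Z: "is_colimiting (Adj K) \<Delta> Z z" and e: "e \<in> hom (Adj K) Z Z" "\<And>n. e \<cdot>\<^bsub>Adj K\<^esub> z n = z n"
    for Z z e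
  proof -
    have zc: "is_cocone (Adj K) \<Delta> Z z" using Z by (simp add: is_colimiting_def)
    then have "Ide (Adj K) Z \<in> hom (Adj K) Z Z" "\<And>n. Ide (Adj K) Z \<cdot>\<^bsub>Adj K\<^esub> z n = z n"
      using A.Ide_hom A.Ide_Cmp unfolding is_cocone_def by blast+
    then show ?thesis
      using Z zc e unfolding is_colimiting_def by blast
  qed
  have cn: "c n \<in> hom (Adj K) (fobj \<Delta> n) X" and dn: "d n \<in> hom (Adj K) (fobj \<Delta> n) Y" for n
    using Xc Yc by (auto simp: is_cocone_def)
  have "g \<cdot>\<^bsub>Adj K\<^esub> h = Ide (Adj K) X"
    by (rule endo[OF X A.Cmp_hom[OF h(1) g(1)]]) (simp add: A.Cmp_assoc[OF cn h(1) g(1)] h g)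
  then have gh: "fst g \<cdot> fst h = Ide K X"
    by (simp add: Cmp_Adj)
  have "h \<cdot>\<^bsub>Adj K\<^esub> g = Ide (Adj K) Y"
    by (rule endo[OF Y A.Cmp_hom[OF g(1) h(1)]]) (simp add: A.Cmp_assoc[OF dn g(1) h(1)] h g)
  then have hg: "fst h \<cdot> fst g = Ide K Y"
    by (simp add: Cmp_Adj)
  have hadj: "adjoint X Y (fst h) (snd h)" and gadj: "adjoint Y X (fst g) (snd g)"
    using h g by (simp_all add: hom_Adj_iff)
  have sh: "snd h = fst g"
    by (rule adjoint_iso[OF hadj gadj gh hg])
  note C = adjoint_chain_functor[OF \<Delta>] and Xa = Xc[unfolded is_cocone_Adj_iff]
  note [simp] = adjointD[OF hadj] adjointD[OF gadj] adjoint_coconeD(2-8)[OF Xa]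
  have dd: "fst (d n) = fst h \<cdot> fst (c n)" "snd (d n) = snd (c n) \<cdot> fst g" for n
    using h(2)[of n] sh by (simp_all add: Cmp_Adj prod_eq_iff)
  have ch: "chain (\<lambda>n. fst (c n) \<cdot> snd (c n))"
    by (rule chain_cocones[OF C Xa Xa])
  have "snd (d n) \<cdot> fst (d n) = snd (c n) \<cdot> fst (c n)" for n
  proof -
    have "snd (d n) \<cdot> fst (d n) = snd (c n) \<cdot> (fst g \<cdot> fst h) \<cdot> fst (c n)"
      unfolding dd by simp
    then show ?thesis unfolding gh by simp
  qed
  moreover have "lub (\<lambda>n. fst (d n) \<cdot> snd (d n)) = Ide K Y"
  proof -
    have "lub (\<lambda>n. fst (d n) \<cdot> snd (d n)) = lub (\<lambda>n. fst h \<cdot> (fst (c n) \<cdot> snd (c n)) \<cdot> fst g)"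
      unfolding dd by simp
    also have "\<dots> = fst h \<cdot> lub (\<lambda>n. fst (c n) \<cdot> snd (c n)) \<cdot> fst g"
      by (simp add: lub_Cmp[OF ch] Cmp_lub chain_Cmp_left[OF ch] del: assoc)
    also have "\<dots> = Ide K Y"
      using ld hg by (simp add: locally_determined_iff[OF \<Delta> Xc])
    finally show ?thesis .
  qed
  ultimately show ?thesis
    using ld by (simp add: locally_determined_iff[OF \<Delta>] Xc Yc)
qed

end

section \<open>Locally continuous functors preserve locally determined cocones\<close>

lemma is_functorD:
  assumes "is_functor C D F" "category C"
  shows "A \<in> Obj C \<Longrightarrow> fobj F A \<in> Obj D"
    and "f \<in> hom C A B \<Longrightarrow> farr F f \<in> hom D (fobj F A) (fobj F B)"
    and "A \<in> Obj C \<Longrightarrow> farr F (Ide C A) = Ide D (fobj F A)"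
    and "\<lbrakk>f \<in> hom C A B; g \<in> hom C B E\<rbrakk> \<Longrightarrow> farr F (g \<cdot>\<^bsub>C\<^esub> f) = farr F g \<cdot>\<^bsub>D\<^esub> farr F f"
  using assms(1) category.hom_Obj[OF assms(2)] unfolding is_functor_def
  by (blast, blast, blast, simp add: hom_def)

lemma is_functor_functor_comp:
  assumes B: "category B" and C: "category C" and F: "is_functor B C F" and G: "is_functor C D G"
  shows "is_functor B D (functor_comp G F)"
proof -
  note F = is_functorD[OF F B] and G = is_functorD[OF G C]
  have "farr G (farr F (g \<cdot>\<^bsub>B\<^esub> f)) = farr G (farr F g) \<cdot>\<^bsub>D\<^esub> farr G (farr F f)"
    if "f \<in> Arr B" "g \<in> Arr B" "Cod B f = Dom B g" for f g
  proof -
    have "f \<in> hom B (Dom B f) (Dom B g)" "g \<in> hom B (Dom B g) (Cod B g)"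
      using that by (auto simp: hom_def)
    then show ?thesis
      using F(2,4) G(4) by metis
  qed
  then show ?thesis
    unfolding is_functor_def functor_comp_def by (simp add: F G)
qed

lemma is_cocone_functor_comp:
  assumes C: "category C" and \<Delta>: "is_functor omega C \<Delta>" and F: "is_functor C D F"
    and c: "is_cocone C \<Delta> X c"
  shows "is_cocone D (functor_comp F \<Delta>) (fobj F X) (\<lambda>n. farr F (c n))"
proof -
  note F = is_functorD[OF F C]
  have X: "X \<in> Obj C" and ch: "\<And>n. c n \<in> hom C (fobj \<Delta> n) X"
    and cc: "\<And>n m. n \<le> m \<Longrightarrow> c m \<cdot>\<^bsub>C\<^esub> farr \<Delta> (n, m) = c n"
    using c by (auto simp: is_cocone_def)
  have "farr F (c m) \<cdot>\<^bsub>D\<^esub> farr F (farr \<Delta> (n, m)) = farr F (c n)" if "n \<le> m" for n m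
  proof -
    have "(n, m) \<in> hom omega n m"
      using that by (simp add: omega_def hom_def)
    then have "farr \<Delta> (n, m) \<in> hom C (fobj \<Delta> n) (fobj \<Delta> m)"
      by (rule is_functorD(2)[OF \<Delta> category_omega])
    from F(4)[OF this ch] show ?thesis
      by (simp add: cc[OF that])
  qed
  then show ?thesis
    unfolding is_cocone_def functor_comp_def using X F(1) F(2)[OF ch] by simp
qed

locale locally_continuous_functor = K: O_category K + L: O_category L for K and L +
  fixes F
  assumes locally_continuous: "locally_continuous K L F"
begin

lemma is_functor: "is_functor K L F"
  using locally_continuous by (simp add: locally_continuous_def)

lemma farr_lub:
  assumes u: "K.chain u"
  shows "L.chain (\<lambda>n. farr F (u n))" and "farr F (K.lub u) = L.lub (\<lambda>n. farr F (u n))"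
proof -
  let ?A = "Dom K (u 0)" and ?B = "Cod K (u 0)"
  have h: "u n \<in> hom K ?A ?B" for n
    using K.chain_Arr[OF u, of n] K.chain_Dom[OF u, of n] K.chain_Cod[OF u, of n]
    by (simp add: hom_def)
  then have o: "?A \<in> Obj K" "?B \<in> Obj K"
    using K.hom_Obj by blast+
  have Fh: "farr F (u n) \<in> hom L (fobj F ?A) (fobj F ?B)" for n
    by (rule is_functorD(2)[OF is_functor K.category_axioms h])
  have "farr F (u n) \<sqsubseteq>\<^bsub>L\<^esub> farr F (u (Suc n))" for n
  proof -
    have "u n \<sqsubseteq>\<^bsub>K\<^esub> u (Suc n)"
      using u by (simp add: K.chain_def K.le_def)
    then show ?thesis
      using locally_continuous o h[of n] h[of "Suc n"] unfolding locally_continuous_def by blast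
  qed
  then show ch: "L.chain (\<lambda>n. farr F (u n))"
    using Fh by (simp add: L.chain_def L.le_iff_Le[OF Fh Fh])
  have "is_lub L (fobj F ?A) (fobj F ?B) (range (\<lambda>n. farr F (u n))) (farr F (K.lub u))"
    using locally_continuous o u K.is_lub_lub[OF u]
    by (auto simp: locally_continuous_def K.increasing_iff_chain)
  then show "farr F (K.lub u) = L.lub (\<lambda>n. farr F (u n))"
    using Fh[of 0] by (subst (asm) L.is_lub_iff[OF ch]) (simp_all add: hom_def)
qed

text \<open>Both conditions equate the supremum of a chain of composites with a composite or an
  identity, all of which \<open>F\<close> preserves.\<close>

lemma locally_determined_image:
  assumes \<Delta>: "is_functor omega (Adj K) \<Delta>" and c: "is_cocone (Adj K) \<Delta> X c"
    and ld: "locally_determined K \<Delta> X c"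
  shows "locally_determined L (functor_comp (Adj_map F) \<Delta>) (fobj F X) (\<lambda>n. farr (Adj_map F) (c n))"
proof -
  have FA: "is_functor (Adj K) (Adj L) (Adj_map F)"
    by (rule is_functor_Adj_map[OF K.O_category_axioms locally_continuous])
  note F\<Delta> = is_functor_functor_comp[OF category_omega K.category_Adj \<Delta> FA]
  have fo: "fobj (Adj_map F) = fobj F"
    by (simp add: Adj_map_def)
  note Fc = is_cocone_functor_comp[OF K.category_Adj \<Delta> FA c, unfolded fo]
  note C = K.adjoint_chain_functor[OF \<Delta>] and X = c[unfolded K.is_cocone_Adj_iff]
  note [simp] = K.adjoint_chainD[OF C] K.adjoint_coconeD(2-8)[OF X]
  note F = is_functorD[OF is_functor K.category_axioms]
  have cmp: "farr F (g \<cdot>\<^bsub>K\<^esub> f) = farr F g \<cdot>\<^bsub>L\<^esub> farr F f"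
    if "f \<in> Arr K" "g \<in> Arr K" "Cod K f = Dom K g" for f g
    using that by (intro F(4)[of f "Dom K f" "Cod K f" g "Cod K g"]) (auto simp: hom_def)
  have pr: "fst (farr (Adj_map F) f) = farr F (fst f)" "snd (farr (Adj_map F) f) = farr F (snd f)" for f
    by (simp_all add: Adj_map_def split_beta)
  have top: "K.lub (\<lambda>n. fst (c n) \<cdot>\<^bsub>K\<^esub> snd (c n)) = Ide K X"
    and det: "K.lub (\<lambda>k. snd (farr \<Delta> (n, n + k)) \<cdot>\<^bsub>K\<^esub> fst (farr \<Delta> (n, n + k)))
      = snd (c n) \<cdot>\<^bsub>K\<^esub> fst (c n)" for n
    using ld by (auto simp: K.locally_determined_iff[OF \<Delta> c])
  have "L.lub (\<lambda>n. farr F (fst (c n)) \<cdot>\<^bsub>L\<^esub> farr F (snd (c n))) = Ide L (fobj F X)"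
    using farr_lub(2)[OF K.chain_cocones[OF C X X]] by (simp add: cmp top F)
  moreover have "L.lub (\<lambda>k. farr F (snd (farr \<Delta> (n, n + k))) \<cdot>\<^bsub>L\<^esub> farr F (fst (farr \<Delta> (n, n + k))))
      = farr F (snd (c n)) \<cdot>\<^bsub>L\<^esub> farr F (fst (c n))" for n
    using farr_lub(2)[OF K.chain_right_left[OF C, of n n n]] by (simp add: cmp det)
  ultimately show ?thesis
    unfolding L.locally_determined_iff[OF F\<Delta> Fc] by (simp add: functor_comp_def pr)
qed

lemma omega_cocontinuous:
  assumes "has_locally_determined_colimits K"
  shows "omega_cocontinuous (Adj K) (Adj L) (Adj_map F)"
  unfolding omega_cocontinuous_def
proof (intro allI impI, elim conjE)
  fix \<Delta> X c
  assume \<Delta>: "is_functor omega (Adj K) \<Delta>" and X: "is_colimiting (Adj K) \<Delta> X c"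
  have c: "is_cocone (Adj K) \<Delta> X c" using X by (simp add: is_colimiting_def)
  have FA: "is_functor (Adj K) (Adj L) (Adj_map F)"
    by (rule is_functor_Adj_map[OF K.O_category_axioms locally_continuous])
  have "locally_determined K \<Delta> X c"
    using assms \<Delta> X by (simp add: has_locally_determined_colimits_def)
  then show "is_colimiting (Adj L) (functor_comp (Adj_map F) \<Delta>) (fobj (Adj_map F) X)
      (\<lambda>n. farr (Adj_map F) (c n))"
    using L.locally_determined_colimiting[OF
        is_functor_functor_comp[OF category_omega K.category_Adj \<Delta> FA]
        is_cocone_functor_comp[OF K.category_Adj \<Delta> FA c]]
      locally_determined_image[OF \<Delta> c] by (simp add: Adj_map_def)
qed

end

section \<open>The O-category of chains and matrices\<close>

text \<open>Matrices are kept as codes under an arbitrary injection \<open>enc\<close>, so that the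
  arrow type of the resulting category can be prescribed from outside.\<close>

locale chain_family = O_category K for K :: "('a, 'b, 'c) O_category_scheme" (structure) +
  fixes I :: "'i set" and D :: "'i \<Rightarrow> nat \<Rightarrow> 'a" and l r :: "'i \<Rightarrow> nat \<Rightarrow> nat \<Rightarrow> 'b"
    and enc :: "(nat \<Rightarrow> nat \<Rightarrow> 'b) \<Rightarrow> 'm"
  assumes chains: "i \<in> I \<Longrightarrow> adjoint_chain (D i) (l i) (r i)"
    and inj_enc: "inj enc"
begin

section \<open>Matrices between chains of adjoint pairs\<close>

abbreviation dec :: "'m \<Rightarrow> nat \<Rightarrow> nat \<Rightarrow> 'b" where "dec \<equiv> inv enc"

lemmas enc_eq_iff [simp] = inj_eq[OF inj_enc]

text \<open>\<open>x m n\<close> leads from stage \<open>n\<close> of the source to stage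
  \<open>m\<close> of the target. Each row is a cocone along the left adjoints of chain
  \<open>i\<close>, each column a cone along the right adjoints of chain \<open>j\<close>.\<close>

definition mat :: "'i \<Rightarrow> 'i \<Rightarrow> (nat \<Rightarrow> nat \<Rightarrow> 'b) \<Rightarrow> bool" where
  "mat i j x \<longleftrightarrow> i \<in> I \<and> j \<in> I \<and>
    (\<forall>m n. x m n \<in> Arr K \<and> Dom K (x m n) = D i n \<and> Cod K (x m n) = D j m) \<and>
    (\<forall>m n n'. n \<le> n' \<longrightarrow> x m n' \<cdot> l i n n' = x m n) \<and>
    (\<forall>m m' n. m \<le> m' \<longrightarrow> r j m m' \<cdot> x m' n = x m n)"

definition mcmp :: "(nat \<Rightarrow> nat \<Rightarrow> 'b) \<Rightarrow> (nat \<Rightarrow> nat \<Rightarrow> 'b) \<Rightarrow> nat \<Rightarrow> nat \<Rightarrow> 'b" where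
  "mcmp y x m n = lub (\<lambda>k. y m k \<cdot> x k n)"

text \<open>The entry goes up from stage \<open>n\<close> and comes down to stage \<open>m\<close>,
  in the limit; starting at \<open>m + n\<close> stays above both indices.\<close>

definition mide :: "'i \<Rightarrow> nat \<Rightarrow> nat \<Rightarrow> 'b" where
  "mide i m n = lub (\<lambda>k. r i m (m + n + k) \<cdot> l i n (m + n + k))"

definition mlub :: "(nat \<Rightarrow> nat \<Rightarrow> nat \<Rightarrow> 'b) \<Rightarrow> nat \<Rightarrow> nat \<Rightarrow> 'b" where
  "mlub X m n = lub (\<lambda>p. X p m n)"

lemmas chainsD [simp] = adjoint_chainD[OF chains]
lemmas chains_adjoint = adjoint_chain_adjoint[OF chains]

lemma matD:
  assumes "mat i j x"
  shows "i \<in> I" "j \<in> I" "x m n \<in> Arr K" "Dom K (x m n) = D i n" "Cod K (x m n) = D j m"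
    "n \<le> n' \<Longrightarrow> x m n' \<cdot> l i n n' = x m n"
    "m \<le> m' \<Longrightarrow> r j m m' \<cdot> x m' n = x m n"
  using assms by (auto simp: mat_def)

text \<open>Passing to stage \<open>Suc p\<close> factors both entries through chain
  \<open>j\<close> and leaves \<open>l \<cdot> r\<close> in the middle, so by the counit the terms
  of a matrix product increase and their supremum makes sense.\<close>

lemma chain_mcmp:
  assumes x: "mat i j x" and y: "mat j k y"
  shows "chain (\<lambda>p. y m p \<cdot> x p n)"
  unfolding chain_def
proof
  fix p
  note [simp] = matD(1-5)[OF x] matD(1-5)[OF y]
  have "y m p \<cdot> x p n = (y m (Suc p) \<cdot> l j p (Suc p)) \<cdot> (r j p (Suc p) \<cdot> x (Suc p) n)"
    using matD(7)[OF x, of p "Suc p"] matD(6)[OF y, of p "Suc p"] by simp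
  also have "\<dots> = y m (Suc p) \<cdot> l j p (Suc p) \<cdot> r j p (Suc p) \<cdot> x (Suc p) n"
    by simp
  also have "\<dots> \<preceq> y m (Suc p) \<cdot> x (Suc p) n"
    by (intro Cmp_le_right adjoint_counit[OF chains_adjoint]) auto
  finally show "y m p \<cdot> x p n \<preceq> y m (Suc p) \<cdot> x (Suc p) n" .
qed

lemma mat_mcmp:
  assumes x: "mat i j x" and y: "mat j k y"
  shows "mat i k (mcmp y x)"
proof -
  note [simp] = matD(1-5)[OF x] matD(1-5)[OF y]
  note ch = chain_mcmp[OF x y]
  have "lub (\<lambda>p. y m p \<cdot> x p n') \<cdot> l i n n' = lub (\<lambda>p. y m p \<cdot> x p n)" if "n \<le> n'" for m n n'
    using that by (simp add: lub_Cmp[OF ch] matD(6)[OF x])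
  moreover have "r k m m' \<cdot> lub (\<lambda>p. y m' p \<cdot> x p n) = lub (\<lambda>p. y m p \<cdot> x p n)" if "m \<le> m'" for m m' n
  proof -
    have "r k m m' \<cdot> y m' p \<cdot> x p n = y m p \<cdot> x p n" for p
      using that by (simp flip: matD(7)[OF y that])
    then show ?thesis
      using that by (simp add: Cmp_lub[OF ch])
  qed
  ultimately show ?thesis
    by (simp add: mat_def mcmp_def ch)
qed

text \<open>Distributing over the inner supremum leaves the same double family on both sides; it
  increases in either index, so the suprema can be exchanged.\<close>

lemma mcmp_assoc:
  assumes x: "mat i j x" and y: "mat j k y" and z: "mat k h z"
  shows "mcmp (mcmp z y) x = mcmp z (mcmp y x)"
proof (intro ext)
  fix m n
  note [simp] = matD(1-5)[OF x] matD(1-5)[OF y] matD(1-5)[OF z]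
  have 1: "chain (\<lambda>q. z m q \<cdot> y q p \<cdot> x p n)" for p
    using chain_Cmp_left[OF chain_mcmp[OF y z], of "x p n" m p] by simp
  have 2: "chain (\<lambda>p. z m q \<cdot> y q p \<cdot> x p n)" for q
    using chain_Cmp_right[OF chain_mcmp[OF x y], of "z m q" q n] by simp
  have "mcmp (mcmp z y) x m n = lub (\<lambda>p. lub (\<lambda>q. z m q \<cdot> y q p \<cdot> x p n))"
    by (simp add: mcmp_def lub_Cmp[OF chain_mcmp[OF y z]])
  also have "\<dots> = lub (\<lambda>q. lub (\<lambda>p. z m q \<cdot> y q p \<cdot> x p n))"
    by (rule lub_swap[OF 1 2])
  also have "\<dots> = mcmp z (mcmp y x) m n"
    by (simp add: mcmp_def Cmp_lub[OF chain_mcmp[OF x y]])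
  finally show "mcmp (mcmp z y) x m n = mcmp z (mcmp y x) m n" .
qed

text \<open>Both sequences are tails of one ascent, hence cofinal in each other. The start can
  therefore be adapted to a computation that needs a larger bound.\<close>

lemma mide_eq:
  assumes i: "i \<in> I" and "m \<le> N" "n \<le> N"
  shows "mide i m n = lub (\<lambda>k. r i m (N + k) \<cdot> l i n (N + k))"
  unfolding mide_def
proof (intro le_antisym lub_mono chain_right_left[OF chains[OF i]])
  note ch = chain_right_left[OF chains[OF i]]
  fix k
  have "r i m (m + n + k) \<cdot> l i n (m + n + k) \<preceq> r i m (N + (m + n + k)) \<cdot> l i n (N + (m + n + k))"
    using chain_mono[OF _ ch[of m "m + n" n], of k "N + k"] by (simp add: ac_simps)
  then show "\<exists>p. r i m (m + n + k) \<cdot> l i n (m + n + k) \<preceq> r i m (N + p) \<cdot> l i n (N + p)"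
    by blast
  have "r i m (N + k) \<cdot> l i n (N + k) \<preceq> r i m (m + n + (N + k)) \<cdot> l i n (m + n + (N + k))"
    using chain_mono[OF _ ch[of m N n], of k "m + n + k"] assms by (simp add: ac_simps)
  then show "\<exists>p. r i m (N + k) \<cdot> l i n (N + k) \<preceq> r i m (m + n + p) \<cdot> l i n (m + n + p)"
    by blast
qed (use assms in auto)

text \<open>Functoriality absorbs the extra chain map, but the supremum still starts beyond the
  larger index; \<open>mide_eq\<close> allows that start for the smaller one.\<close>

lemma mat_mide:
  assumes i [simp]: "i \<in> I"
  shows "mat i i (mide i)"
proof -
  note ch = chain_right_left[OF chains[OF i]]
  have "mide i m n' \<cdot> l i n n' = mide i m n" if "n \<le> n'" for m n n'
  proof -
    have "(r i m (m + n' + k) \<cdot> l i n' (m + n' + k)) \<cdot> l i n n' = r i m (m + n' + k) \<cdot> l i n (m + n' + k)" for k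
      using that by (simp add: adjoint_chain_Cmp[OF chains[OF i]])
    then show ?thesis
      using that by (simp add: mide_def[of i m n'] lub_Cmp[OF ch] mide_eq[of i m "m + n'" n] del: assoc)
  qed
  moreover have "r i m m' \<cdot> mide i m' n = mide i m n" if "m \<le> m'" for m m' n
  proof -
    have "r i m m' \<cdot> r i m' (m' + n + k) \<cdot> l i n (m' + n + k) = r i m (m' + n + k) \<cdot> l i n (m' + n + k)" for k
      using that by (simp add: adjoint_chain_Cmp[OF chains[OF i]])
    then show ?thesis
      using that by (simp add: mide_def[of i m' n] Cmp_lub[OF ch] mide_eq[of i m "m' + n" n])
  qed
  ultimately show ?thesis
    by (simp add: mat_def) (simp add: mide_def ch)
qed

text \<open>Every term is below \<open>x m n\<close>: writing \<open>x k n\<close> as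
  \<open>r j k q \<cdot> x q n\<close> produces a counit, and \<open>r j m q \<cdot> x q n\<close>
  is again \<open>x m n\<close>. Conversely, the unit puts \<open>x m n\<close> below one of the
  terms.\<close>

lemma mcmp_mide_left:
  assumes x: "mat i j x"
  shows "mcmp (mide j) x = x"
proof (intro ext le_antisym)
  fix m n
  note [simp] = matD(1-5)[OF x]
  have j: "j \<in> I" by simp
  note mj = mat_mide[OF j]
  note ch = chain_mcmp[OF x mj] and chj = chain_right_left[OF chains[OF j]]
  have e: "mide j m k \<cdot> x k n = lub (\<lambda>p. r j m (m + k + p) \<cdot> l j k (m + k + p) \<cdot> x k n)" for k
    by (simp add: mide_def lub_Cmp[OF chj])
  have chx: "chain (\<lambda>p. r j m (m + k + p) \<cdot> l j k (m + k + p) \<cdot> x k n)" for k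
    using chain_Cmp_left[OF chj[of m "m + k" k], of "x k n"] by simp
  show "mcmp (mide j) x m n \<preceq> x m n"
    unfolding mcmp_def
  proof (rule lub_least[OF ch])
    fix k
    show "mide j m k \<cdot> x k n \<preceq> x m n"
      unfolding e
    proof (rule lub_least[OF chx])
      fix p
      let ?q = "m + k + p"
      have "r j m ?q \<cdot> l j k ?q \<cdot> x k n = r j m ?q \<cdot> l j k ?q \<cdot> r j k ?q \<cdot> x ?q n"
        using matD(7)[OF x, of k ?q] by simp
      also have "\<dots> \<preceq> r j m ?q \<cdot> x ?q n"
        by (intro Cmp_le_right adjoint_counit[OF chains_adjoint]) auto
      also have "\<dots> = x m n"
        by (rule matD(7)[OF x]) simp
      finally show "r j m ?q \<cdot> l j k ?q \<cdot> x k n \<preceq> x m n" .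
    qed
  qed
  \<comment> \<open>This is the term \<open>k = m\<close>, \<open>p = 0\<close> of the iterated
    supremum; the sum is left unevaluated to match it.\<close>
  have "x m n \<preceq> r j m (m + m + 0) \<cdot> l j m (m + m + 0) \<cdot> x m n"
    by (intro adjoint_unit[OF chains_adjoint]) auto
  then have "x m n \<preceq> mide j m m \<cdot> x m n"
    unfolding e by (rule le_lub[OF chx])
  then show "x m n \<preceq> mcmp (mide j) x m n"
    unfolding mcmp_def by (rule le_lub[OF ch])
qed

lemma mcmp_mide_right:
  assumes x: "mat i j x"
  shows "mcmp x (mide i) = x"
proof (intro ext le_antisym)
  fix m n
  note [simp] = matD(1-5)[OF x]
  have i: "i \<in> I" by simp
  note mi = mat_mide[OF i]
  note ch = chain_mcmp[OF mi x] and chi = chain_right_left[OF chains[OF i]]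
  have e: "x m k \<cdot> mide i k n = lub (\<lambda>p. x m k \<cdot> r i k (k + n + p) \<cdot> l i n (k + n + p))" for k
    by (simp add: mide_def Cmp_lub[OF chi])
  have chx: "chain (\<lambda>p. x m k \<cdot> r i k (k + n + p) \<cdot> l i n (k + n + p))" for k
    using chain_Cmp_right[OF chi[of k "k + n" n], of "x m k"] by simp
  show "mcmp x (mide i) m n \<preceq> x m n"
    unfolding mcmp_def
  proof (rule lub_least[OF ch])
    fix k
    show "x m k \<cdot> mide i k n \<preceq> x m n"
      unfolding e
    proof (rule lub_least[OF chx])
      fix p
      let ?q = "k + n + p"
      have "x m k \<cdot> r i k ?q \<cdot> l i n ?q = (x m ?q \<cdot> l i k ?q) \<cdot> r i k ?q \<cdot> l i n ?q"
        using matD(6)[OF x, of k ?q] by simp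
      also have "\<dots> = x m ?q \<cdot> l i k ?q \<cdot> r i k ?q \<cdot> l i n ?q"
        by simp
      also have "\<dots> \<preceq> x m ?q \<cdot> l i n ?q"
        by (intro Cmp_le_right adjoint_counit[OF chains_adjoint]) auto
      also have "\<dots> = x m n"
        by (rule matD(6)[OF x]) simp
      finally show "x m k \<cdot> r i k ?q \<cdot> l i n ?q \<preceq> x m n" .
    qed
  qed
  \<comment> \<open>The unit enters to the right of \<open>x m n\<close>, hence the explicit
    identity; the term is the one with \<open>k = n\<close> and \<open>p = 0\<close>.\<close>
  have "x m n \<cdot> Ide K (D i n) \<preceq> x m n \<cdot> r i n (n + n + 0) \<cdot> l i n (n + n + 0)"
    using chains_adjoint[OF i, of n "n + n + 0"] by (intro Cmp_le_right) (simp_all add: adjoint_def)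
  then have "x m n \<preceq> x m n \<cdot> mide i n n"
    unfolding e by (intro le_lub[OF chx, where n = 0]) simp
  then show "x m n \<preceq> mcmp x (mide i) m n"
    unfolding mcmp_def by (rule le_lub[OF ch])
qed

section \<open>Entrywise suprema of matrices\<close>

lemma mat_mlub:
  assumes X: "\<And>p. mat i j (X p)" and ch: "\<And>m n. chain (\<lambda>p. X p m n)"
  shows "mat i j (mlub X)"
  using matD(1,2)[OF X[of 0]]
  by (simp add: mat_def mlub_def ch matD[OF X] lub_Cmp Cmp_lub)

text \<open>Composition in \<open>K\<close> distributes over the supremum in each entry; what
  remains is to exchange it with the supremum of the matrix product.\<close>

lemma mcmp_mlub_right:
  assumes X: "\<And>p. mat i j (X p)" and ch: "\<And>m n. chain (\<lambda>p. X p m n)" and y: "mat j k y"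
  shows "chain (\<lambda>p. mcmp y (X p) m n)" and "mlub (\<lambda>p. mcmp y (X p)) = mcmp y (mlub X)"
proof -
  note [simp] = matD(1-5)[OF y] matD(1-5)[OF X]
  have c: "chain (\<lambda>p. y m k \<cdot> X p k n)" for m n k
    by (intro chain_Cmp_right ch) simp_all
  show "chain (\<lambda>p. mcmp y (X p) m n)"
    unfolding mcmp_def using c by (intro chain_lub chain_mcmp[OF X y]) (simp add: chain_def)
  show "mlub (\<lambda>p. mcmp y (X p)) = mcmp y (mlub X)"
    by (intro ext) (simp add: mcmp_def mlub_def Cmp_lub ch lub_swap[OF chain_mcmp[OF X y] c])
qed

lemma mcmp_mlub_left:
  assumes x: "mat i j x" and Y: "\<And>p. mat j k (Y p)" and ch: "\<And>m n. chain (\<lambda>p. Y p m n)"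
  shows "chain (\<lambda>p. mcmp (Y p) x m n)" and "mlub (\<lambda>p. mcmp (Y p) x) = mcmp (mlub Y) x"
proof -
  note [simp] = matD(1-5)[OF x] matD(1-5)[OF Y]
  have c: "chain (\<lambda>p. Y p m k \<cdot> x k n)" for m n k
    by (intro chain_Cmp_left ch) simp_all
  show "chain (\<lambda>p. mcmp (Y p) x m n)"
    unfolding mcmp_def using c by (intro chain_lub chain_mcmp[OF x Y]) (simp add: chain_def)
  show "mlub (\<lambda>p. mcmp (Y p) x) = mcmp (mlub Y) x"
    by (intro ext) (simp add: mcmp_def mlub_def lub_Cmp ch lub_swap[OF chain_mcmp[OF x Y] c])
qed

text \<open>Arrows store their domain and codomain because one matrix may fit several pairs of
  indices, for instance when two of them carry the same chain.\<close>

definition mcat :: "('i, 'i \<times> 'i \<times> 'm) O_category" where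
  "mcat = \<lparr>Obj = I, Arr = {(i, j, g). \<exists>x. mat i j x \<and> g = enc x},
    Dom = fst, Cod = fst \<circ> snd, Ide = (\<lambda>i. (i, i, enc (mide i))),
    Cmp = (\<lambda>g f. (fst f, fst (snd g), enc (mcmp (dec (snd (snd g))) (dec (snd (snd f)))))),
    Le = (\<lambda>f g. \<forall>m n. dec (snd (snd f)) m n \<preceq> dec (snd (snd g)) m n)\<rparr>"

lemma mcat_simps [simp]:
  "Obj mcat = I" "Ide mcat i = (i, i, enc (mide i))"
  "(j', k, enc y) \<cdot>\<^bsub>mcat\<^esub> (i, j, enc x) = (i, k, enc (mcmp y x))"
  "(i, j, enc x) \<sqsubseteq>\<^bsub>mcat\<^esub> (i', j', enc x') \<longleftrightarrow> (\<forall>m n. x m n \<preceq> x' m n)"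
  by (simp_all add: mcat_def inv_f_f[OF inj_enc])

lemma hom_mcat: "f \<in> hom mcat i j \<longleftrightarrow> (\<exists>x. mat i j x \<and> f = (i, j, enc x))"
  by (auto simp: hom_def mcat_def)

lemma hom_mcatE:
  assumes "f \<in> hom mcat i j"
  obtains x where "mat i j x" "f = (i, j, enc x)"
  using assms by (auto simp: hom_mcat)

lemma category_mcat: "category mcat"
proof
  fix i j k h f g e
  show "f \<in> Arr mcat \<Longrightarrow> Dom mcat f \<in> Obj mcat" "f \<in> Arr mcat \<Longrightarrow> Cod mcat f \<in> Obj mcat"
    by (auto simp: mcat_def mat_def)
  show "i \<in> Obj mcat \<Longrightarrow> Ide mcat i \<in> hom mcat i i"
    by (simp add: hom_mcat mat_mide)
  show "\<lbrakk>f \<in> hom mcat i j; g \<in> hom mcat j k\<rbrakk> \<Longrightarrow> g \<cdot>\<^bsub>mcat\<^esub> f \<in> hom mcat i k"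
    by (auto simp: hom_mcat mat_mcmp)
  show "f \<in> hom mcat i j \<Longrightarrow> f \<cdot>\<^bsub>mcat\<^esub> Ide mcat i = f"
    "f \<in> hom mcat i j \<Longrightarrow> Ide mcat j \<cdot>\<^bsub>mcat\<^esub> f = f"
    by (auto simp: hom_mcat mcmp_mide_left mcmp_mide_right)
  show "\<lbrakk>f \<in> hom mcat i j; g \<in> hom mcat j k; e \<in> hom mcat k h\<rbrakk>
      \<Longrightarrow> (e \<cdot>\<^bsub>mcat\<^esub> g) \<cdot>\<^bsub>mcat\<^esub> f = e \<cdot>\<^bsub>mcat\<^esub> g \<cdot>\<^bsub>mcat\<^esub> f"
    by (auto simp: hom_mcat mcmp_assoc)
qed

lemma increasing_mcatE:
  assumes "increasing mcat i j u"
  obtains X where "\<And>p. mat i j (X p)" "\<And>m n. chain (\<lambda>p. X p m n)" "u = (\<lambda>p. (i, j, enc (X p)))"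
proof -
  have "\<forall>p. \<exists>x. mat i j x \<and> u p = (i, j, enc x)"
    using assms by (simp add: increasing_def hom_mcat)
  then obtain X where X: "\<And>p. mat i j (X p)" "\<And>p. u p = (i, j, enc (X p))"
    by metis
  then have "X p m n \<preceq> X (Suc p) m n" for p m n
    using assms by (simp add: increasing_def)
  then show thesis
    using X by (intro that[of X]) (auto simp: chain_def)
qed

lemma is_lub_mcat:
  assumes X: "\<And>p. mat i j (X p)" and ch: "\<And>m n. chain (\<lambda>p. X p m n)"
  shows "is_lub mcat i j (range (\<lambda>p. (i, j, enc (X p)))) (i, j, enc (mlub X))"
  using mat_mlub[OF X ch]
  by (auto simp: is_lub_def hom_mcat) (auto simp: mlub_def intro: lub_upper lub_least ch)

text \<open>The continuity axioms speak of an arbitrary least upper bound. Antisymmetry in each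
  entry identifies it with the entrywise one; the general uniqueness result presupposes an
  O-category, which is still to be shown here.\<close>

lemma is_lub_mcatD:
  assumes X: "\<And>p. mat i j (X p)" and ch: "\<And>m n. chain (\<lambda>p. X p m n)"
    and s: "is_lub mcat i j (range (\<lambda>p. (i, j, enc (X p)))) s"
  shows "s = (i, j, enc (mlub X))"
proof -
  note t = is_lub_mcat[OF X ch]
  obtain y where y: "s = (i, j, enc y)"
    using s by (auto simp: is_lub_def elim: hom_mcatE)
  have "s \<sqsubseteq>\<^bsub>mcat\<^esub> (i, j, enc (mlub X))" "(i, j, enc (mlub X)) \<sqsubseteq>\<^bsub>mcat\<^esub> s"
    using s t unfolding is_lub_def by blast+
  then show ?thesis
    unfolding y by (simp add: fun_eq_iff le_antisym)
qed

text \<open>Order and suprema are entrywise, so the order axioms come from \<open>K\<close>, and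
  continuity of composition is the exchange of two suprema.\<close>

lemma O_category_mcat: "O_category mcat"
proof (intro O_category.intro category_mcat O_category_axioms.intro)
  fix i j k u s f f' g g'
  show "reflp_on (hom mcat i j) (\<sqsubseteq>\<^bsub>mcat\<^esub>)"
    by (rule reflp_onI) (auto simp: hom_mcat matD)
  show "transp_on (hom mcat i j) (\<sqsubseteq>\<^bsub>mcat\<^esub>)"
    by (rule transp_onI) (auto simp: hom_mcat, blast intro: le_trans)
  show "antisymp_on (hom mcat i j) (\<sqsubseteq>\<^bsub>mcat\<^esub>)"
    by (rule antisymp_onI) (auto simp: hom_mcat fun_eq_iff, blast intro: le_antisym)
  show "\<exists>s. is_lub mcat i j (range u) s" if "increasing mcat i j u"
    using that by (rule increasing_mcatE) (use is_lub_mcat in blast)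
  show "g \<cdot>\<^bsub>mcat\<^esub> f \<sqsubseteq>\<^bsub>mcat\<^esub> g' \<cdot>\<^bsub>mcat\<^esub> f'"
    if f: "f \<in> hom mcat i j" and f': "f' \<in> hom mcat i j"
      and g: "g \<in> hom mcat j k" and g': "g' \<in> hom mcat j k"
      and le: "f \<sqsubseteq>\<^bsub>mcat\<^esub> f'" "g \<sqsubseteq>\<^bsub>mcat\<^esub> g'"
  proof -
    obtain x where x: "mat i j x" "f = (i, j, enc x)" using f by (rule hom_mcatE)
    obtain x' where x': "mat i j x'" "f' = (i, j, enc x')" using f' by (rule hom_mcatE)
    obtain y where y: "mat j k y" "g = (j, k, enc y)" using g by (rule hom_mcatE)
    obtain y' where y': "mat j k y'" "g' = (j, k, enc y')" using g' by (rule hom_mcatE)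
    have "mcmp y x m n \<preceq> mcmp y' x' m n" for m n
    proof -
      have "y m p \<cdot> x p n \<preceq> y' m p \<cdot> x' p n" for p
        using le x y x' y' by (intro Cmp_le) (simp_all add: matD(5)[OF x(1)] matD(4)[OF y(1)])
      then show ?thesis
        unfolding mcmp_def by (blast intro: lub_mono chain_mcmp x y x' y')
    qed
    then show ?thesis by (simp add: x y x' y')
  qed
  show "is_lub mcat i k (range (\<lambda>n. g \<cdot>\<^bsub>mcat\<^esub> u n)) (g \<cdot>\<^bsub>mcat\<^esub> s)"
    if u: "increasing mcat i j u" and s: "is_lub mcat i j (range u) s" and g: "g \<in> hom mcat j k"
  proof -
    obtain X where X: "\<And>p. mat i j (X p)" "\<And>m n. chain (\<lambda>p. X p m n)" "u = (\<lambda>p. (i, j, enc (X p)))"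
      using u by (rule increasing_mcatE) blast
    obtain y where y: "mat j k y" "g = (j, k, enc y)" using g by (rule hom_mcatE)
    have "s = (i, j, enc (mlub X))"
      using s unfolding X(3) by (rule is_lub_mcatD[OF X(1,2)])
    then show ?thesis
      using is_lub_mcat[OF mat_mcmp[OF X(1) y(1)] mcmp_mlub_right(1)[OF X(1,2) y(1)]]
      by (simp add: X(3) y(2) mcmp_mlub_right(2)[OF X(1,2) y(1)])
  qed
  show "is_lub mcat i k (range (\<lambda>n. u n \<cdot>\<^bsub>mcat\<^esub> f)) (s \<cdot>\<^bsub>mcat\<^esub> f)"
    if u: "increasing mcat j k u" and s: "is_lub mcat j k (range u) s" and f: "f \<in> hom mcat i j"
  proof -
    obtain Y where Y: "\<And>p. mat j k (Y p)" "\<And>m n. chain (\<lambda>p. Y p m n)" "u = (\<lambda>p. (j, k, enc (Y p)))"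
      using u by (rule increasing_mcatE) blast
    obtain x where x: "mat i j x" "f = (i, j, enc x)" using f by (rule hom_mcatE)
    have "s = (j, k, enc (mlub Y))"
      using s unfolding Y(3) by (rule is_lub_mcatD[OF Y(1,2)])
    then show ?thesis
      using is_lub_mcat[OF mat_mcmp[OF x(1) Y(1)] mcmp_mlub_left(1)[OF x(1) Y(1,2)]]
      by (simp add: Y(3) x(2) mcmp_mlub_left(2)[OF x(1) Y(1,2)])
  qed
qed

end

section \<open>Adjoining a locally determined colimit\<close>

locale chain_extension = O_category K for K :: "('a, 'b, 'c) O_category_scheme" (structure) +
  fixes D :: "nat \<Rightarrow> 'a" and l r :: "nat \<Rightarrow> nat \<Rightarrow> 'b"
    and enc :: "(nat \<Rightarrow> nat \<Rightarrow> 'b) \<Rightarrow> 'm"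
  assumes adjoint_chain: "adjoint_chain D l r"
    and inj_enc: "inj enc"
begin

text \<open>\<open>None\<close> is the new object and carries the given chain; \<open>Some A\<close>
  carries the constant chain at \<open>A\<close> with identity adjunctions.\<close>

sublocale E: chain_family K "insert None (Some ` Obj K)" "case_option D (\<lambda>A _. A)"
  "case_option l (\<lambda>A _ _. Ide K A)" "case_option r (\<lambda>A _ _. Ide K A)" enc
proof unfold_locales
  fix i
  assume "i \<in> insert None (Some ` Obj K)"
  then show "adjoint_chain (case i of None \<Rightarrow> D | Some A \<Rightarrow> \<lambda>_. A)
      (case i of None \<Rightarrow> l | Some A \<Rightarrow> \<lambda>_ _. Ide K A) (case i of None \<Rightarrow> r | Some A \<Rightarrow> \<lambda>_ _. Ide K A)"
    using adjoint_chain by (auto simp: adjoint_chain_def[of "\<lambda>_. _"] adjoint_def)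
qed (rule inj_enc)

section \<open>The embedding by constant matrices\<close>

definition emb :: "('a, 'b, 'a option, 'a option \<times> 'a option \<times> 'm) functor_map" where
  "emb = \<lparr>fobj = Some, farr = (\<lambda>f. (Some (Dom K f), Some (Cod K f), enc (\<lambda>_ _. f)))\<rparr>"

lemma mat_const: "f \<in> hom K A B \<Longrightarrow> E.mat (Some A) (Some B) (\<lambda>_ _. f)"
  by (auto simp: E.mat_def hom_def)

lemma mcmp_const: "f \<in> hom K A B \<Longrightarrow> g \<in> hom K B C \<Longrightarrow> E.mcmp (\<lambda>_ _. g) (\<lambda>_ _. f) = (\<lambda>_ _. g \<cdot> f)"
  by (auto simp: E.mcmp_def hom_def fun_eq_iff)

lemma mide_Some: "A \<in> Obj K \<Longrightarrow> E.mide (Some A) = (\<lambda>_ _. Ide K A)"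
  by (auto simp: E.mide_def fun_eq_iff)

lemma farr_emb: "f \<in> hom K A B \<Longrightarrow> farr emb f = (Some A, Some B, enc (\<lambda>_ _. f))"
  by (auto simp: emb_def hom_def)

lemma fobj_emb [simp]: "fobj emb = Some"
  by (simp add: emb_def)

lemma locally_continuous_emb: "locally_continuous K E.mcat emb"
proof -
  have "is_functor K E.mcat emb"
    unfolding is_functor_def
  proof (intro conjI ballI impI)
    fix A assume "A \<in> Obj K"
    then show "fobj emb A \<in> Obj E.mcat" "farr emb (Ide K A) = Ide E.mcat (fobj emb A)"
      by (simp_all add: farr_emb[OF Ide_hom] mide_Some)
  next
    fix A B f assume "f \<in> hom K A B"
    then show "farr emb f \<in> hom E.mcat (fobj emb A) (fobj emb B)"
      by (simp add: farr_emb E.hom_mcat mat_const)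
  next
    fix f g assume "f \<in> Arr K" "g \<in> Arr K" "Cod K f = Dom K g"
    then have f: "f \<in> hom K (Dom K f) (Dom K g)" and g: "g \<in> hom K (Dom K g) (Cod K g)"
      by (simp_all add: hom_def)
    show "farr emb (g \<cdot> f) = farr emb g \<cdot>\<^bsub>E.mcat\<^esub> farr emb f"
      by (simp add: farr_emb[OF f] farr_emb[OF g] farr_emb[OF Cmp_hom[OF f g]] mcmp_const[OF f g])
  qed
  moreover have "farr emb f \<sqsubseteq>\<^bsub>E.mcat\<^esub> farr emb g"
    if "f \<in> hom K A B" "g \<in> hom K A B" "f \<sqsubseteq> g" for f g A B
    using that by (simp add: farr_emb le_iff_Le)
  moreover have "is_lub E.mcat (Some A) (Some B) (range (\<lambda>n. farr emb (u n))) (farr emb s)"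
    if "increasing K A B u" "is_lub K A B (range u) s" for A B u s
  proof -
    have u: "chain u" "Dom K (u 0) = A" "Cod K (u 0) = B" and h: "u n \<in> hom K A B" for n
      using that(1) increasing_iff_chain by (auto simp: increasing_def)
    have s: "s = lub u" and sh: "s \<in> hom K A B"
      using that(2) is_lub_iff[OF u] by (auto simp: is_lub_def)
    have "E.mlub (\<lambda>p _ _. u p) = (\<lambda>_ _. s)"
      by (simp add: E.mlub_def s fun_eq_iff)
    then show ?thesis
      using E.is_lub_mcat[of "Some A" "Some B" "\<lambda>p _ _. u p"] u(1)
      by (simp add: farr_emb[OF h] farr_emb[OF sh] mat_const[OF h])
  qed
  ultimately show ?thesis
    by (simp add: locally_continuous_def)
qed

text \<open>On each hom-set \<open>emb\<close> is an order embedding: an upper bound in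
  \<open>K\<close> becomes one among the matrices, and the comparison obtained there descends to
  \<open>K\<close>.\<close>

lemma is_lub_emb_reflect:
  assumes "is_lub E.mcat (Some A) (Some B) (farr emb ` S) (farr emb s)"
    and S: "S \<subseteq> hom K A B" and s: "s \<in> hom K A B"
  shows "is_lub K A B S s"
proof -
  have le: "farr emb f \<sqsubseteq>\<^bsub>E.mcat\<^esub> farr emb g \<longleftrightarrow> f \<sqsubseteq> g" if "f \<in> hom K A B" "g \<in> hom K A B" for f g
    using that by (simp add: farr_emb le_iff_Le)
  have h: "farr emb f \<in> hom E.mcat (Some A) (Some B)" if "f \<in> hom K A B" for f
    using that by (simp add: farr_emb E.hom_mcat mat_const)
  have "s \<sqsubseteq> t" if t: "t \<in> hom K A B" and ub: "\<And>f. f \<in> S \<Longrightarrow> f \<sqsubseteq> t" for t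
  proof -
    have "\<forall>f\<in>farr emb ` S. f \<sqsubseteq>\<^bsub>E.mcat\<^esub> farr emb t"
      using S t ub le by auto
    then have "farr emb s \<sqsubseteq>\<^bsub>E.mcat\<^esub> farr emb t"
      using assms(1) h[OF t] unfolding is_lub_def by blast
    then show ?thesis
      using le s t by simp
  qed
  moreover have "f \<sqsubseteq> s" if "f \<in> S" for f
    using assms(1) S s le that by (auto simp: is_lub_def subset_iff)
  ultimately show ?thesis
    using s by (auto simp: is_lub_def)
qed

section \<open>The cocone of columns and rows of the identity matrix\<close>

definition univ_cocone :: "nat \<Rightarrow> ('a option \<times> 'a option \<times> 'm) \<times> ('a option \<times> 'a option \<times> 'm)" where
  "univ_cocone n = ((Some (D n), None, enc (\<lambda>m _. E.mide None m n)),
    (None, Some (D n), enc (\<lambda>_ k. E.mide None n k)))"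

lemma mat_None: "E.mat None None (E.mide None)"
  by (rule E.mat_mide) simp

text \<open>A column or row inherits one compatibility from the identity matrix; the other concerns
  the constant chain at \<open>D n\<close>, where it is trivial.\<close>

lemma mat_univ_cocone:
  "E.mat (Some (D n)) None (\<lambda>m _. E.mide None m n)" "E.mat None (Some (D n)) (\<lambda>_ k. E.mide None n k)"
  using E.matD[OF mat_None] adjoint_chainD(1)[OF adjoint_chain] by (simp_all add: E.mat_def)

text \<open>Composing through the constant chain at \<open>D n\<close> takes the supremum of a
  constant sequence. Composing through \<open>None\<close> gives an entry of the square of the
  identity matrix, that is, of the identity matrix itself.\<close>

lemma mcmp_univ_cocone:
  "E.mcmp (\<lambda>m _. E.mide None m n) (\<lambda>_ k. E.mide None n k) = (\<lambda>m k. E.mide None m n \<cdot> E.mide None n k)"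
  "E.mcmp (\<lambda>_ k. E.mide None n k) (\<lambda>m _. E.mide None m n) = (\<lambda>_ _. E.mide None n n)"
proof -
  note [simp] = E.matD(1-5)[OF mat_None]
  show "E.mcmp (\<lambda>m _. E.mide None m n) (\<lambda>_ k. E.mide None n k)
      = (\<lambda>m k. E.mide None m n \<cdot> E.mide None n k)"
    by (simp add: E.mcmp_def fun_eq_iff)
  have "E.mcmp (E.mide None) (E.mide None) n n = E.mide None n n"
    by (simp add: E.mcmp_mide_left[OF mat_None])
  then show "E.mcmp (\<lambda>_ k. E.mide None n k) (\<lambda>m _. E.mide None m n) = (\<lambda>_ _. E.mide None n n)"
    by (simp add: E.mcmp_def fun_eq_iff)
qed

text \<open>The diagonal entries are exactly the suprema in the second condition of local
  determinedness.\<close>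

lemma mide_None: "E.mide None n n = lub (\<lambda>k. r n (n + k) \<cdot> l n (n + k))"
  using E.mide_eq[of None n n n] by simp

text \<open>Column times row is one term of the supremum that defines the square of the identity
  matrix, which yields the counit. For the unit, the first term of the diagonal entry, at stage
  \<open>n\<close> itself, is the identity.\<close>

lemma is_cocone_univ_cocone:
  assumes \<Delta>: "fobj \<Delta> = D" "\<And>n m. farr \<Delta> (n, m) = (l n m, r n m)"
  shows "is_cocone (Adj E.mcat) (functor_comp (Adj_map emb) \<Delta>) None univ_cocone"
proof -
  note [simp] = E.matD(1-5)[OF mat_None] adjoint_chainD[OF adjoint_chain]
  have lh: "l n m \<in> hom K (D n) (D m)" and rh: "r n m \<in> hom K (D m) (D n)" if "n \<le> m" for n m
    using that by (simp_all add: hom_def)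
  have "univ_cocone n \<in> hom (Adj E.mcat) (Some (D n)) None" for n
  proof -
    have "E.mide None m n \<cdot> E.mide None n k \<preceq> E.mcmp (E.mide None) (E.mide None) m k" for m k
      unfolding E.mcmp_def by (rule lub_upper[OF E.chain_mcmp[OF mat_None mat_None]])
    moreover have "Ide K (D n) \<preceq> E.mide None n n"
      unfolding mide_None
      by (rule le_lub[OF chain_right_left[OF adjoint_chain], where n = 0]) simp_all
    ultimately show ?thesis
      by (simp add: univ_cocone_def hom_Adj E.hom_mcat mat_univ_cocone mcmp_univ_cocone mide_Some
          E.mcmp_mide_left[OF mat_None])
  qed
  moreover have "univ_cocone m \<cdot>\<^bsub>Adj E.mcat\<^esub> farr (Adj_map emb) (l n m, r n m) = univ_cocone n"
    if nm: "n \<le> m" for n m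
    using nm E.matD(6)[OF mat_None nm] E.matD(7)[OF mat_None nm]
    by (simp add: univ_cocone_def Adj_map_def farr_emb[OF lh] farr_emb[OF rh] E.mcmp_def fun_eq_iff)
  ultimately show ?thesis
    by (simp add: is_cocone_def functor_comp_def \<Delta>) (simp add: Adj_map_def)
qed

lemma locally_determined_univ_cocone:
  assumes \<Delta>: "fobj \<Delta> = D" "\<And>n m. farr \<Delta> (n, m) = (l n m, r n m)"
  shows "locally_determined E.mcat (functor_comp (Adj_map emb) \<Delta>) None univ_cocone"
proof -
  note [simp] = E.matD(1-5)[OF mat_None] adjoint_chainD[OF adjoint_chain]
  have lh: "l n m \<in> hom K (D n) (D m)" and rh: "r n m \<in> hom K (D m) (D n)" if "n \<le> m" for n m
    using that by (simp_all add: hom_def)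
  let ?X = "\<lambda>n m k. E.mide None m n \<cdot> E.mide None n k"
  have X: "E.mat None None (?X n)" for n
    using E.mat_mcmp[OF mat_univ_cocone(2,1)] by (simp add: mcmp_univ_cocone)
  have "{fst (univ_cocone n) \<cdot>\<^bsub>E.mcat\<^esub> snd (univ_cocone n) | n. True}
      = range (\<lambda>n. (None, None, enc (?X n)))"
    by (auto simp: univ_cocone_def mcmp_univ_cocone)
  \<comment> \<open>The supremum of all products of column \<open>n\<close> and row \<open>n\<close>
    is by definition the square of the identity matrix.\<close>
  moreover have "E.mlub ?X = E.mcmp (E.mide None) (E.mide None)"
    by (simp add: E.mlub_def E.mcmp_def fun_eq_iff)
  ultimately have 1: "is_lub E.mcat None None
      {fst (univ_cocone n) \<cdot>\<^bsub>E.mcat\<^esub> snd (univ_cocone n) | n. True} (Ide E.mcat None)"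
    using E.is_lub_mcat[of None None ?X, OF X E.chain_mcmp[OF mat_None mat_None]]
    by (simp add: E.mcmp_mide_left[OF mat_None])
  have 2: "is_lub E.mcat (Some (D n)) (Some (D n))
      {snd (farr (Adj_map emb) (farr \<Delta> (n, m))) \<cdot>\<^bsub>E.mcat\<^esub> fst (farr (Adj_map emb) (farr \<Delta> (n, m))) | m. n \<le> m}
      (snd (univ_cocone n) \<cdot>\<^bsub>E.mcat\<^esub> fst (univ_cocone n))" for n
  proof -
    let ?Y = "\<lambda>k _ _. r n (n + k) \<cdot> l n (n + k)"
    have Y: "E.mat (Some (D n)) (Some (D n)) (?Y k)" for k
      by (rule mat_const[OF Cmp_hom[OF lh rh]]) simp_all
    have "snd (farr (Adj_map emb) (farr \<Delta> (n, m))) \<cdot>\<^bsub>E.mcat\<^esub> fst (farr (Adj_map emb) (farr \<Delta> (n, m)))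
        = (Some (D n), Some (D n), enc (\<lambda>_ _. r n m \<cdot> l n m))" if nm: "n \<le> m" for m
      by (simp add: \<Delta> Adj_map_def farr_emb[OF lh[OF nm]] farr_emb[OF rh[OF nm]]
          mcmp_const[OF lh[OF nm] rh[OF nm]])
    then have "{snd (farr (Adj_map emb) (farr \<Delta> (n, m))) \<cdot>\<^bsub>E.mcat\<^esub>
          fst (farr (Adj_map emb) (farr \<Delta> (n, m))) | m. n \<le> m}
        = range (\<lambda>k. (Some (D n), Some (D n), enc (?Y k)))"
      unfolding Collect_ge_eq_range by simp
    moreover have "snd (univ_cocone n) \<cdot>\<^bsub>E.mcat\<^esub> fst (univ_cocone n)
        = (Some (D n), Some (D n), enc (E.mlub ?Y))"
      by (simp add: univ_cocone_def mcmp_univ_cocone mide_None E.mlub_def fun_eq_iff)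
    ultimately show ?thesis
      using E.is_lub_mcat[OF Y chain_right_left[OF adjoint_chain]] by simp
  qed
  show ?thesis
    unfolding locally_determined_def using 1 2 by (simp add: functor_comp_def \<Delta>(1)) (simp add: Adj_map_def)
qed

text \<open>Functoriality of \<open>emb\<close> turns the two conditions on the image cocone into
  suprema of \<open>emb\<close>-images of sets of arrows of \<open>K\<close>, which
  \<open>emb\<close> reflects.\<close>

lemma locally_determined_emb_reflect:
  assumes \<Delta>: "is_functor omega (Adj K) \<Delta>" and c: "is_cocone (Adj K) \<Delta> X c"
    and ld: "locally_determined E.mcat (functor_comp (Adj_map emb) \<Delta>) (Some X)
      (\<lambda>n. farr (Adj_map emb) (c n))"
  shows "locally_determined K \<Delta> X c"
proof -
  note C = adjoint_chain_functor[OF \<Delta>] and X = c[unfolded is_cocone_Adj_iff]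
  note [simp] = adjoint_chainD[OF C] adjoint_coconeD(2-8)[OF X]
  have emb: "farr emb (g \<cdot> f) = farr emb g \<cdot>\<^bsub>E.mcat\<^esub> farr emb f"
    if "f \<in> Arr K" "g \<in> Arr K" "Cod K f = Dom K g" for f g
    using locally_continuous_emb that by (simp add: locally_continuous_def is_functor_def)
  have pr: "fst (farr (Adj_map emb) f) = farr emb (fst f)" "snd (farr (Adj_map emb) f) = farr emb (snd f)" for f
    by (simp_all add: Adj_map_def split_beta)
  have fo: "fobj (functor_comp (Adj_map emb) \<Delta>) n = Some (fobj \<Delta> n)"
    "farr (functor_comp (Adj_map emb) \<Delta>) f = farr (Adj_map emb) (farr \<Delta> f)" for n f
    by (simp_all add: functor_comp_def Adj_map_def)
  have 1: "farr emb ` {fst (c n) \<cdot> snd (c n) | n. True}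
      = {farr emb (fst (c n)) \<cdot>\<^bsub>E.mcat\<^esub> farr emb (snd (c n)) | n. True}"
    by (simp add: full_SetCompr_eq image_image emb)
  have 2: "farr emb ` {snd (farr \<Delta> (n, m)) \<cdot> fst (farr \<Delta> (n, m)) | m. n \<le> m}
      = {farr emb (snd (farr \<Delta> (n, m))) \<cdot>\<^bsub>E.mcat\<^esub> farr emb (fst (farr \<Delta> (n, m))) | m. n \<le> m}" for n
    unfolding Collect_ge_eq_range by (simp add: image_image emb)
  have 3: "Ide E.mcat (Some X) = farr emb (Ide K X)"
    using locally_continuous_emb adjoint_coconeD(2)[OF X]
    by (simp add: locally_continuous_def is_functor_def)
  have 4: "farr emb (snd (c n)) \<cdot>\<^bsub>E.mcat\<^esub> farr emb (fst (c n)) = farr emb (snd (c n) \<cdot> fst (c n))" for n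
    by (simp add: emb)
  show ?thesis
    unfolding locally_determined_def
  proof (intro conjI allI is_lub_emb_reflect)
    show "is_lub E.mcat (Some X) (Some X) (farr emb ` {fst (c n) \<cdot> snd (c n) | n. True}) (farr emb (Ide K X))"
      using ld unfolding locally_determined_def fo pr 1 3 by blast
    show "is_lub E.mcat (Some (fobj \<Delta> n)) (Some (fobj \<Delta> n))
        (farr emb ` {snd (farr \<Delta> (n, m)) \<cdot> fst (farr \<Delta> (n, m)) | m. n \<le> m})
        (farr emb (snd (c n) \<cdot> fst (c n)))" for n
      using ld unfolding locally_determined_def fo pr 2 4 by blast
  qed (auto simp: hom_def)
qed

end

section \<open>The two implications and the choice of types\<close>

lemma has_locally_determined_colimits_cocontinuous:
  assumes "O_category K" "has_locally_determined_colimits K" "O_category L" "locally_continuous K L F"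
  shows "omega_cocontinuous (Adj K) (Adj L) (Adj_map F)"
proof -
  interpret locally_continuous_functor K L F
    using assms by (simp add: locally_continuous_functor_def locally_continuous_functor_axioms_def)
  show ?thesis by (rule omega_cocontinuous[OF assms(2)])
qed

text \<open>Makes matrices fit into the last component of \<open>univ_arr\<close>, which consists of
  functions from sequences to sequences: the row index has to be coded as a sequence.\<close>

lemma ex_inj_matrix: "\<exists>enc :: (nat \<Rightarrow> nat \<Rightarrow> 'a) \<Rightarrow> (nat \<Rightarrow> 'a) \<Rightarrow> nat \<Rightarrow> 'a. inj enc"
proof (cases "\<exists>a b :: 'a. a \<noteq> b")
  case True
  then obtain a b :: 'a where ab: "a \<noteq> b" by blast
  \<comment> \<open>The number \<open>n\<close> becomes the sequence whose only \<open>a\<close> is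
    at position \<open>n\<close>; a matrix then becomes the function that decodes its argument and
    returns that row.\<close>
  let ?\<iota> = "\<lambda>n i :: nat. if i = n then a else b"
  have inj: "inj ?\<iota>"
    using ab by (auto simp: inj_def fun_eq_iff)
  have "inj (\<lambda>(x :: nat \<Rightarrow> nat \<Rightarrow> 'a) s. x (inv ?\<iota> s))"
  proof (intro injI ext)
    fix x y :: "nat \<Rightarrow> nat \<Rightarrow> 'a" and k n
    assume "(\<lambda>s. x (inv ?\<iota> s)) = (\<lambda>s. y (inv ?\<iota> s))"
    from fun_cong[OF this, of "?\<iota> k"] show "x k n = y k n"
      by (simp add: inv_f_f[OF inj])
  qed
  then show ?thesis by (rule exI[of inj])
next
  case False
  then have "x = y" for x y :: "nat \<Rightarrow> nat \<Rightarrow> 'a"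
    by (intro ext) blast
  \<comment> \<open>With a single value available all matrices are equal, so any function is
    injective.\<close>
  then have "inj (undefined :: (nat \<Rightarrow> nat \<Rightarrow> 'a) \<Rightarrow> (nat \<Rightarrow> 'a) \<Rightarrow> nat \<Rightarrow> 'a)"
    by (intro injI)
  then show ?thesis by (rule exI[of inj])
qed

text \<open>The extension is built for the chain at hand, so \<open>cocont\<close> is applied to an
  \<open>L\<close> that depends on that chain; \<open>enc\<close> fixes the type in which its
  matrices are coded.\<close>

lemma (in O_category) has_locally_determined_colimitsI:
  fixes enc :: "(nat \<Rightarrow> nat \<Rightarrow> 'b) \<Rightarrow> 'm"
  assumes enc: "inj enc"
    and cocont: "\<And>(L :: ('a option, 'a option \<times> 'a option \<times> 'm) O_category) F.
      O_category L \<Longrightarrow> locally_continuous K L F \<Longrightarrow> omega_cocontinuous (Adj K) (Adj L) (Adj_map F)"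
  shows "has_locally_determined_colimits K"
  unfolding has_locally_determined_colimits_def
proof (intro allI impI, elim conjE)
  fix \<Delta> X c
  assume \<Delta>: "is_functor omega (Adj K) \<Delta>" and X: "is_colimiting (Adj K) \<Delta> X c"
  have c: "is_cocone (Adj K) \<Delta> X c" using X by (simp add: is_colimiting_def)
  interpret chain_extension K "fobj \<Delta>" "\<lambda>n m. fst (farr \<Delta> (n, m))" "\<lambda>n m. snd (farr \<Delta> (n, m))" enc
    by unfold_locales (simp_all add: adjoint_chain_functor[OF \<Delta>] enc)
  interpret M: O_category E.mcat by (rule E.O_category_mcat)
  have F: "is_functor (Adj K) (Adj E.mcat) (Adj_map emb)"
    by (rule is_functor_Adj_map[OF O_category_axioms locally_continuous_emb])
  note F\<Delta> = is_functor_functor_comp[OF category_omega category_Adj \<Delta> F]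
  have "is_colimiting (Adj E.mcat) (functor_comp (Adj_map emb) \<Delta>) (fobj (Adj_map emb) X)
      (\<lambda>n. farr (Adj_map emb) (c n))"
    using cocont[OF M.O_category_axioms locally_continuous_emb] \<Delta> X
    unfolding omega_cocontinuous_def by blast
  then have colim: "is_colimiting (Adj E.mcat) (functor_comp (Adj_map emb) \<Delta>) (Some X)
      (\<lambda>n. farr (Adj_map emb) (c n))"
    by (simp add: Adj_map_def)
  have q: "is_cocone (Adj E.mcat) (functor_comp (Adj_map emb) \<Delta>) None univ_cocone"
    "locally_determined E.mcat (functor_comp (Adj_map emb) \<Delta>) None univ_cocone"
    by (simp_all add: is_cocone_univ_cocone locally_determined_univ_cocone)
  show "locally_determined K \<Delta> X c"
    \<comment> \<open>The image of \<open>c\<close> and \<open>univ_cocone\<close> are colimits of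
      the same chain, so local determinedness passes from the second to the first and from there
      down to \<open>K\<close>.\<close>
    using M.locally_determined_iso[OF F\<Delta> M.locally_determined_colimiting[OF F\<Delta> q] q(2) colim]
    by (rule locally_determined_emb_reflect[OF \<Delta> c])
qed

text \<open>The equivalence lets \<open>L\<close> range over types large enough for the extension of
  \<open>K\<close>; the second conjunct carries the forward implication to O-categories over
  arbitrary types.\<close>

theorem mainTheorem4:
  fixes K :: "('o, 'a) O_category"
  assumes "O_category K"
  shows "(has_locally_determined_colimits K \<longleftrightarrow>
      (\<forall>(L :: ('o option, ('o, 'a) univ_arr) O_category) F.
        O_category L \<and> locally_continuous K L F \<longrightarrow>
        omega_cocontinuous (Adj K) (Adj L) (Adj_map F)))
    \<and> (has_locally_determined_colimits K \<longrightarrow>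
      (\<forall>(L :: ('p, 'b) O_category) F.
        O_category L \<and> locally_continuous K L F \<longrightarrow>
        omega_cocontinuous (Adj K) (Adj L) (Adj_map F)))"
proof -
  interpret K: O_category K by (rule assms)
  obtain enc :: "(nat \<Rightarrow> nat \<Rightarrow> 'a) \<Rightarrow> (nat \<Rightarrow> 'a) \<Rightarrow> nat \<Rightarrow> 'a" where "inj enc"
    using ex_inj_matrix by blast
  note colimits = K.has_locally_determined_colimitsI[OF this]
    and cocont = has_locally_determined_colimits_cocontinuous[OF assms]
  show ?thesis
  proof (intro conjI iffI impI allI; (elim conjE)?)
    assume *: "\<forall>(L :: ('o option, ('o, 'a) univ_arr) O_category) F.
      O_category L \<and> locally_continuous K L F \<longrightarrow> omega_cocontinuous (Adj K) (Adj L) (Adj_map F)"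
    show "has_locally_determined_colimits K"
      by (rule colimits, rule *[rule_format], rule conjI)
  \<comment> \<open>The goals left are the forward implication at the two choices of types for
    \<open>L\<close>.\<close>
  qed (erule (2) cocont)+
qed

end
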